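(* (1) Let $$Z_n=[u^n]\prod_{k\geq1}\frac1{1-\exp(-k^2/(2n))u^k}.$$ Let $c$ be the unique real solution of $\int_0^\infty\frac{x}{\exp(cx+x^2/2)-1}\,dx=1$. Then, as $n\to\infty$, $$\log Z_n\sim\left(c+\int_0^\infty-\log(1-\exp(-cx-x^2/2))\,dx\right)\sqrt n.$$ (2) Let $$Z_n^{\rm dist}=[u^n]\prod_{k\geq1}\bigl(1+\exp(-k^2/(2n))u^k\bigr).$$ If $c_d$ is the unique real solution of $\int_0^\infty\frac{x}{\exp(c_dx+x^2/2)+1}\,dx=1$, then, as $n\to\infty$, $$\log Z_n^{\rm dist}\sim\left(c_d+\int_0^\infty\log(1+\exp(-c_dx-x^2/2))\,dx\right)\sqrt n.$$
   Context: $[u^n]f(u)$ denotes the coefficient of $u^n$ in the power series $f(u)$. The equation for $c$ is considered for those $c$ for which the integral converges (i.e. $c>0$). $a_n\sim b_n$ means $a_n/b_n\to1$. *)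

theory Defs
  imports "HOL-Analysis.Analysis" "HOL-Library.Landau_Symbols"
begin

definition gauss_weight :: "nat \<Rightarrow> nat \<Rightarrow> real" where
  "gauss_weight n k = exp (- (real k)\<^sup>2 / (2 * real n))"

text \<open>
  The infinite products are products of formal power series, convergent with respect to the
  coefficientwise topology on \<^typ>\<open>real fps\<close>. The factor for \<open>k \<ge> 1\<close> has index \<open>k - 1\<close>.
\<close>

definition Z :: "nat \<Rightarrow> real" where
  "Z n = fps_nth (\<Prod>j. 1 / (1 - fps_const (gauss_weight n (Suc j)) * fps_X ^ Suc j)) n"

definition Z_dist :: "nat \<Rightarrow> real" where
  "Z_dist n = fps_nth (\<Prod>j. 1 + fps_const (gauss_weight n (Suc j)) * fps_X ^ Suc j) n"

text \<open>
  The equations determining \<open>c\<close> and \<open>c\<^sub>d\<close>, where \<open>c\<close> ranges over all real numbers: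
  \<^const>\<open>has_integral\<close> includes the convergence of the integral.
  The Bose integral converges only for \<open>c > 0\<close>, the Fermi integral for all \<open>c\<close>.
\<close>

definition bose_eq :: "real \<Rightarrow> bool" where
  "bose_eq c \<longleftrightarrow> ((\<lambda>x. x / (exp (c * x + x\<^sup>2 / 2) - 1)) has_integral 1) {0..}"

definition fermi_eq :: "real \<Rightarrow> bool" where
  "fermi_eq c \<longleftrightarrow> ((\<lambda>x. x / (exp (c * x + x\<^sup>2 / 2) + 1)) has_integral 1) {0..}"

end

theory Submission
  imports Defs
begin

text \<open>
  Put \<open>u = exp (- c / sqrt n)\<close>. At \<open>u\<close> the logarithm of the generating function is a sum of the
  logarithms of its factors, hence \<open>sqrt n\<close> times a Riemann sum. Since all coefficients are
  nonnegative, \<open>Z n * u ^ n\<close> is at most the value at \<open>u\<close>, which gives the upper bound.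

  For the lower bound, keep only parts of size between \<open>\<delta> * sqrt n\<close> and \<open>L * sqrt n\<close>. The equation
  for \<open>c\<close> says that under the weights \<open>u ^ m\<close> the mean size is about \<open>n\<close> without this truncation;
  with it the mean is slightly below \<open>n\<close>, and by exponential Markov bounds most of the mass sits on
  sizes \<open>m\<close> in a window just below \<open>n\<close>. The missing \<open>n - m\<close> is supplied by parts of size at most
  \<open>\<delta> * sqrt n\<close> at a cost \<open>exp (- \<delta> * sqrt n)\<close>: by ones in the Bose case, and by a subset of
  \<open>{1..K}\<close> with prescribed sum in the Fermi case.
\<close>

subsection \<open>Generating functions with nonnegative coefficients\<close>

text \<open>Only the logarithm on the scale sqrt n is wanted, so factors exp (o (sqrt n)) may be
  lost, and Markov bounds can stand in for a local limit theorem or a contour integral.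
  Concentration places the mass in a window of width \<eta> * n, not at n itself. Reserving the
  small parts closes this gap: the two sets of parts are disjoint, so the product factors and its
  coefficient of degree n is a sum of nonnegative terms. Two demands act on \<eta>. It must exceed
  the share of the mean that is removed with the small parts, or else the window misses the mass;
  and the small parts must be able to make up every deficit up to \<eta> * n. For distinct parts
  these are compatible because each occupation is strictly below 1, so that all small parts together
  sum to more than their mean contribution. For repeated parts, copies of 1 make up any deficit at
  bounded cost. Both statistics share one argument through a sign \<sigma>. They differ in this
  filling, in the range of c, and in the behaviour near 0, where the Bose logarithm is
  unbounded.\<close>

definition fps_nonneg :: "real fps \<Rightarrow> bool" where
  "fps_nonneg A \<longleftrightarrow> (\<forall>m. 0 \<le> fps_nth A m)"

lemma fps_nonnegD: "fps_nonneg A \<Longrightarrow> 0 \<le> fps_nth A m"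
  by (simp add: fps_nonneg_def)

lemma fps_nonneg_1 [simp]: "fps_nonneg 1"
  by (simp add: fps_nonneg_def)

lemma fps_nonneg_mult: "fps_nonneg A \<Longrightarrow> fps_nonneg B \<Longrightarrow> fps_nonneg (A * B)"
  by (simp add: fps_nonneg_def fps_mult_nth sum_nonneg)

lemma fps_nonneg_prod: "(\<And>k. k \<in> I \<Longrightarrow> fps_nonneg (F k)) \<Longrightarrow> fps_nonneg (\<Prod>k\<in>I. F k)"
  by (induction I rule: infinite_finite_induct) (auto intro: fps_nonneg_mult)

lemma fps_prod_nth_0:
  fixes F :: "'a \<Rightarrow> real fps"
  shows "(\<And>k. k \<in> I \<Longrightarrow> fps_nth (F k) 0 = 1) \<Longrightarrow> fps_nth (\<Prod>k\<in>I. F k) 0 = 1"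
  by (induction I rule: infinite_finite_induct) auto

lemma fps_mult_nth_ge:
  assumes "fps_nonneg A" "fps_nonneg B"
  shows "fps_nth A m * fps_nth B j \<le> fps_nth (A * B) (m + j)"
proof -
  have "fps_nth A m * fps_nth B (m + j - m) \<le> (\<Sum>i=0..m + j. fps_nth A i * fps_nth B (m + j - i))"
    using assms by (intro member_le_sum) (auto simp: fps_nonneg_def)
  then show ?thesis by (simp add: fps_mult_nth)
qed

lemma fps_mult_nth_ge_left:
  assumes "fps_nonneg A" "fps_nonneg B" "fps_nth B 0 = 1"
  shows "fps_nth A m \<le> fps_nth (A * B) m"
  using fps_mult_nth_ge[OF assms(1,2), of m 0] assms(3) by simp

text \<open>Nonnegative coefficients and u \<ge> 0 turn convergence into absolute convergence, which
  the Cauchy product needs.\<close>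

lemma sums_fps_mult:
  assumes A: "fps_nonneg A" "(\<lambda>m. fps_nth A m * u ^ m) sums a"
    and B: "fps_nonneg B" "(\<lambda>m. fps_nth B m * u ^ m) sums b"
    and u: "u \<ge> 0"
  shows "(\<lambda>m. fps_nth (A * B) m * u ^ m) sums (a * b)"
proof -
  have norm: "norm (fps_nth C m * u ^ m) = fps_nth C m * u ^ m" if "fps_nonneg C" for C m
    using that u by (simp add: fps_nonneg_def)
  have "(\<lambda>k. \<Sum>i\<le>k. (fps_nth A i * u ^ i) * (fps_nth B (k - i) * u ^ (k - i))) sums
      ((\<Sum>k. fps_nth A k * u ^ k) * (\<Sum>k. fps_nth B k * u ^ k))"
    using A B by (intro Cauchy_product_sums) (simp_all only: norm sums_iff)
  moreover have "(\<Sum>i\<le>k. (fps_nth A i * u ^ i) * (fps_nth B (k - i) * u ^ (k - i))) =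
      fps_nth (A * B) k * u ^ k" for k
    unfolding fps_mult_nth sum_distrib_right atLeast0AtMost
    by (intro sum.cong) (auto simp: mult_ac simp flip: power_add)
  ultimately show ?thesis using A(2) B(2) by (simp add: sums_iff)
qed

lemma sums_fps_prod:
  assumes "finite I" and "u \<ge> 0" and "\<And>k. k \<in> I \<Longrightarrow> fps_nonneg (F k)"
    and "\<And>k. k \<in> I \<Longrightarrow> (\<lambda>m. fps_nth (F k) m * u ^ m) sums g k"
  shows "(\<lambda>m. fps_nth (\<Prod>k\<in>I. F k) m * u ^ m) sums (\<Prod>k\<in>I. g k)"
  using assms(1,3,4)
proof (induction I)
  case empty
  have "(\<lambda>m. fps_nth 1 m * u ^ m) = (\<lambda>m. if m = 0 then 1 else 0)"
    by auto
  then show ?case using sums_single[of 0 "\<lambda>_. 1::real"] by simp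
next
  case (insert k I)
  then show ?case using assms(2) by (auto intro!: sums_fps_mult fps_nonneg_prod)
qed

text \<open>Apart from its constant term 1, factor j starts at degree j + 1 or later. Hence the
  coefficient of degree m no longer changes after m factors.\<close>

lemma fps_nth_prodinf:
  fixes F :: "nat \<Rightarrow> real fps"
  assumes F0: "\<And>j. fps_nth (F j) 0 = 1" and F: "\<And>i j. 0 < i \<Longrightarrow> i \<le> j \<Longrightarrow> fps_nth (F j) i = 0"
  shows "fps_nth (\<Prod>j. F j) n = fps_nth (\<Prod>j<n. F j) n"
proof -
  have Suc: "fps_nth (\<Prod>j<Suc N. F j) m = fps_nth (\<Prod>j<N. F j) m" if "m \<le> N" for N m
  proof -
    have "fps_nth (\<Prod>j<Suc N. F j) m = (\<Sum>i=0..m. fps_nth (\<Prod>j<N. F j) i * fps_nth (F N) (m - i))"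
      by (simp add: fps_mult_nth)
    also have "\<dots> = (\<Sum>i=0..m. if i = m then fps_nth (\<Prod>j<N. F j) i else 0)"
      using that F0 F by (intro sum.cong) auto
    also have "\<dots> = fps_nth (\<Prod>j<N. F j) m" by simp
    finally show ?thesis .
  qed
  have stable: "fps_nth (\<Prod>j<N. F j) m = fps_nth (\<Prod>j<m. F j) m" if "m \<le> N" for N m
    using that
  proof (induction rule: dec_induct)
    case (step N)
    then show ?case using Suc[of m N] by (simp del: prod.lessThan_Suc)
  qed simp
  define G where "G = Abs_fps (\<lambda>m. fps_nth (\<Prod>j<m. F j) m)"
  have "(\<lambda>N. \<Prod>j\<le>N. F j) \<longlonglongrightarrow> G"
  proof (rule tendsto_fpsI)
    fix m
    show "\<forall>\<^sub>F N in sequentially. fps_nth (\<Prod>j\<le>N. F j) m = fps_nth G m"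
      using eventually_ge_at_top[of m]
    proof eventually_elim
      case (elim N)
      then show ?case using stable[of m "Suc N"]
        by (simp add: G_def lessThan_Suc_atMost del: prod.lessThan_Suc)
    qed
  qed
  \<comment> \<open>\<open>raw_has_prod\<close> demands a nonzero limit; the constant term provides
    it.\<close>
  moreover have "fps_nth G 0 = 1" by (simp add: G_def)
  then have "G \<noteq> 0" by auto
  ultimately have "F has_prod G" by (auto simp: has_prod_def raw_has_prod_def)
  then have "(\<Prod>j. F j) = G" by (metis has_prod_unique)
  then show ?thesis by (simp add: G_def)
qed

text \<open>The sign \<open>\<sigma> = 1\<close> stands for Fermi statistics (distinct parts), \<open>\<sigma> = -1\<close> for Bose statistics.\<close>

definition factor :: "real \<Rightarrow> nat \<Rightarrow> nat \<Rightarrow> real fps" where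
  "factor \<sigma> n k = (if \<sigma> = 1 then 1 + fps_const (gauss_weight n k) * fps_X ^ k
     else 1 / (1 - fps_const (gauss_weight n k) * fps_X ^ k))"

lemma gauss_weight_pos: "0 < gauss_weight n k"
  by (simp add: gauss_weight_def)

lemma gauss_weight_le_1: "gauss_weight n k \<le> 1"
  by (simp add: gauss_weight_def)

lemma fps_geometric:
  assumes "k > 0"
  shows "1 / (1 - fps_const (w::real) * fps_X ^ k) =
    Abs_fps (\<lambda>m. if k dvd m then w ^ (m div k) else 0)" (is "1 / ?d = ?g")
proof -
  have "fps_nth (?d * ?g) m = fps_nth 1 m" for m
  proof (cases "m < k")
    case True
    then show ?thesis using assms
      by (auto simp: left_diff_distrib mult.assoc fps_X_power_mult_nth dest: dvd_imp_le)
  next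
    case False
    then have "k dvd m - k \<longleftrightarrow> k dvd m" by (simp add: dvd_minus_self)
    moreover have "m div k = Suc ((m - k) div k)"
      using False assms by (simp add: le_div_geq)
    ultimately show ?thesis using assms False
      by (auto simp: left_diff_distrib mult.assoc fps_X_power_mult_nth)
  qed
  then have "?d * ?g = 1" by (intro fps_ext) 
  then have "inverse ?d = ?g" by (rule fps_inverse_unique)
  moreover have "1 / ?d = inverse ?d" using assms by (subst fps_divide_unit) auto
  ultimately show ?thesis by simp
qed

lemma factor_nth_bose:
  "k > 0 \<Longrightarrow> \<sigma> \<noteq> 1 \<Longrightarrow> fps_nth (factor \<sigma> n k) m = (if k dvd m then gauss_weight n k ^ (m div k) else 0)"
  by (simp add: factor_def fps_geometric)

lemma factor_nth_fermi:
  "k > 0 \<Longrightarrow> fps_nth (factor 1 n k) m = (if m = 0 then 1 else if m = k then gauss_weight n k else 0)"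
  by (simp add: factor_def)

lemma factor_nonneg: "k > 0 \<Longrightarrow> fps_nonneg (factor \<sigma> n k)"
  using gauss_weight_pos[of n k]
  by (cases "\<sigma> = 1") (auto simp: fps_nonneg_def factor_nth_bose factor_nth_fermi)

lemma factor_nth_0: "k > 0 \<Longrightarrow> fps_nth (factor \<sigma> n k) 0 = 1"
  by (cases "\<sigma> = 1") (auto simp: factor_nth_bose factor_nth_fermi)

lemma factor_nth_less: "0 < i \<Longrightarrow> i < k \<Longrightarrow> fps_nth (factor \<sigma> n k) i = 0"
  by (cases "\<sigma> = 1") (auto simp: factor_nth_bose factor_nth_fermi dest: dvd_imp_le)

text \<open>The value \<open>exp (\<sigma> * ln (1 + \<sigma> * w))\<close> covers both
  \<open>1 + w\<close> and \<open>1 / (1 - w)\<close>, and turns products over parts into sums in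
  the exponent. For \<sigma> = -1 the series is geometric, spread over the multiples of k.\<close>

lemma sums_factor:
  assumes "\<sigma> = 1 \<or> \<sigma> = -1 \<and> gauss_weight n k * u ^ k < 1" "k > 0" "u \<ge> 0"
  shows "(\<lambda>m. fps_nth (factor \<sigma> n k) m * u ^ m) sums exp (\<sigma> * ln (1 + \<sigma> * (gauss_weight n k * u ^ k)))"
proof -
  define w where "w = gauss_weight n k"
  have w: "w > 0" by (simp add: w_def gauss_weight_pos)
  show ?thesis
  proof (cases "\<sigma> = 1")
    case True
    have "(\<lambda>m. \<Sum>i\<in>{0, k}. if m = i then fps_nth (factor 1 n k) i * u ^ i else 0) sums
        (\<Sum>i\<in>{0, k}. fps_nth (factor 1 n k) i * u ^ i)"
      by (intro sums_sum sums_single)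
    moreover have "(\<Sum>i\<in>{0, k}. if m = i then fps_nth (factor 1 n k) i * u ^ i else 0) =
        fps_nth (factor 1 n k) m * u ^ m" for m
      using assms(2) by (simp add: factor_nth_fermi)
    ultimately have "(\<lambda>m. fps_nth (factor 1 n k) m * u ^ m) sums (1 + w * u ^ k)"
      using assms(2) by (simp add: factor_nth_fermi w_def)
    moreover have "1 + w * u ^ k > 0" using w assms(3) by (intro add_pos_nonneg) auto
    ultimately show ?thesis using True by (simp add: w_def)
  next
    case False
    then have \<sigma>: "\<sigma> = -1" and less: "w * u ^ k < 1" using assms(1) by (auto simp: w_def)
    have "(\<lambda>j. (w * u ^ k) ^ j) sums (1 / (1 - w * u ^ k))"
      using less w assms(3) by (intro geometric_sums) auto
    then have "(\<lambda>j. fps_nth (factor \<sigma> n k) (k * j) * u ^ (k * j)) sums (1 / (1 - w * u ^ k))"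
      using assms(2) \<sigma> by (simp add: factor_nth_bose w_def power_mult power_mult_distrib)
    moreover have "strict_mono (\<lambda>j. k * j)" using assms(2) by (simp add: strict_mono_def)
    moreover have "fps_nth (factor \<sigma> n k) m * u ^ m = 0" if "m \<notin> range (\<lambda>j. k * j)" for m
      using that assms(2) \<sigma> by (auto simp: factor_nth_bose dvd_def)
    ultimately have "(\<lambda>m. fps_nth (factor \<sigma> n k) m * u ^ m) sums (1 / (1 - w * u ^ k))"
      using sums_mono_reindex[of "\<lambda>j. k * j" "\<lambda>m. fps_nth (factor \<sigma> n k) m * u ^ m"] by simp
    moreover have "exp (\<sigma> * ln (1 + \<sigma> * (w * u ^ k))) = 1 / (1 - w * u ^ k)"
      using \<sigma> less by (simp add: exp_minus inverse_eq_divide)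
    ultimately show ?thesis by (simp add: w_def)
  qed
qed

text \<open>Parts larger than n cannot contribute to degree n, so a finite product is
  enough.\<close>

definition Z_stat :: "real \<Rightarrow> nat \<Rightarrow> real" where
  "Z_stat \<sigma> n = fps_nth (\<Prod>k\<in>{1..n}. factor \<sigma> n k) n"

lemma prodinf_factor: "fps_nth (\<Prod>j. factor \<sigma> n (Suc j)) n = Z_stat \<sigma> n"
proof -
  have "fps_nth (\<Prod>j. factor \<sigma> n (Suc j)) n = fps_nth (\<Prod>j<n. factor \<sigma> n (Suc j)) n"
    by (intro fps_nth_prodinf factor_nth_0 factor_nth_less) auto
  also have "(\<Prod>j<n. factor \<sigma> n (Suc j)) = (\<Prod>k\<in>{1..n}. factor \<sigma> n k)"
    by (simp add: lessThan_atLeast0 prod.atLeast1_atMost_eq)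
  finally show ?thesis by (simp add: Z_stat_def)
qed

lemma Z_eq: "Z n = Z_stat (-1) n"
  by (simp add: Z_def factor_def flip: prodinf_factor)

lemma Z_dist_eq: "Z_dist n = Z_stat 1 n"
  by (simp add: Z_dist_def factor_def flip: prodinf_factor)

text \<open>The omitted factors have nonnegative coefficients and constant term 1: omitting parts
  can only lower a coefficient.\<close>

lemma Z_stat_ge_nth:
  assumes "I \<subseteq> {1..n}"
  shows "fps_nth (\<Prod>k\<in>I. factor \<sigma> n k) n \<le> Z_stat \<sigma> n"
proof -
  have "(\<Prod>k\<in>{1..n}. factor \<sigma> n k) = (\<Prod>k\<in>I. factor \<sigma> n k) * (\<Prod>k\<in>{1..n} - I. factor \<sigma> n k)"
    using assms by (simp add: prod.subset_diff mult.commute)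
  then show ?thesis unfolding Z_stat_def using assms
    by (auto intro!: fps_mult_nth_ge_left fps_nonneg_prod factor_nonneg fps_prod_nth_0 factor_nth_0)
qed

section \<open>Prescribed sizes made from small parts\<close>

text \<open>Take j copies of the part 1. Their weight is exp (- j / (2 * n)), and j \<le> n.\<close>

lemma small_parts_bose:
  assumes "K \<ge> 1" "j \<le> n" "n > 0" "\<sigma> \<noteq> 1"
  shows "exp (- 1 / 2) \<le> fps_nth (\<Prod>k\<in>{1..K}. factor \<sigma> n k) j"
proof -
  have "real j / (2 * real n) \<le> 1 / 2" using assms by (simp add: field_simps)
  then have "exp (- 1 / 2) \<le> gauss_weight n 1 ^ j"
    by (simp add: gauss_weight_def flip: exp_of_nat_mult)
  also have "\<dots> = fps_nth (factor \<sigma> n 1) j"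
    using assms by (simp add: factor_nth_bose)
  also have "\<dots> \<le> fps_nth (factor \<sigma> n 1 * (\<Prod>k\<in>{1..K} - {1}. factor \<sigma> n k)) j"
    by (auto intro!: fps_mult_nth_ge_left fps_nonneg_prod factor_nonneg fps_prod_nth_0 factor_nth_0)
  also have "factor \<sigma> n 1 * (\<Prod>k\<in>{1..K} - {1}. factor \<sigma> n k) = (\<Prod>k\<in>{1..K}. factor \<sigma> n k)"
    using assms by (intro prod.remove[symmetric]) auto
  finally show ?thesis .
qed

text \<open>Every \<open>j \<le> K (K + 1) / 2\<close> is a sum of distinct elements of \<open>{1..K}\<close>.\<close>

lemma small_parts_fermi_weight:
  assumes "2 * j \<le> K * (K + 1)"
  shows "(\<Prod>k\<in>{1..K}. gauss_weight n k) \<le> fps_nth (\<Prod>k\<in>{1..K}. factor 1 n k) j"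
  using assms
proof (induction K arbitrary: j)
  case 0
  then show ?case by simp
next
  case (Suc K)
  let ?B = "\<Prod>k\<in>{1..K}. factor 1 n k" and ?W = "\<Prod>k\<in>{1..K}. gauss_weight n k"
  have nn: "fps_nonneg ?B" "fps_nonneg (factor 1 n (Suc K))"
    by (auto intro!: fps_nonneg_prod factor_nonneg)
  have W: "?W \<ge> 0" by (intro prod_nonneg) (simp add: gauss_weight_pos less_imp_le)
  have eq: "(\<Prod>k\<in>{1..Suc K}. factor 1 n k) = ?B * factor 1 n (Suc K)"
    "(\<Prod>k\<in>{1..Suc K}. gauss_weight n k) = ?W * gauss_weight n (Suc K)"
    by (simp_all add: atLeastAtMostSuc_conv mult.commute)
  show ?case
  proof (cases "2 * j \<le> K * (K + 1)")
    case True
    have "?W * gauss_weight n (Suc K) \<le> ?W"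
      using W gauss_weight_le_1 by (simp add: mult_left_le)
    also have "\<dots> \<le> fps_nth ?B j" by (rule Suc.IH[OF True])
    also have "\<dots> \<le> fps_nth (?B * factor 1 n (Suc K)) j"
      using nn by (intro fps_mult_nth_ge_left) (auto simp: factor_nth_0)
    finally show ?thesis unfolding eq .
  next
    case False
    \<comment> \<open>Greedy choice: a j too large for the parts up to K uses the part K + 1, and
      the remainder j - (K + 1) is again at most K * (K + 1) / 2. Bounding by the product of all
      weights, each at most 1, makes the estimate independent of the chosen subset.\<close>
    have "Suc K \<le> j"
    proof (cases K)
      case (Suc K')
      have "2 * K \<le> K * (K + 1)" using Suc by simp
      with False show ?thesis by linarith
    qed (use False in auto)
    have le: "2 * (j - Suc K) \<le> K * (K + 1)" using Suc.prems by (simp add: algebra_simps)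
    have "?W * gauss_weight n (Suc K) \<le> fps_nth ?B (j - Suc K) * gauss_weight n (Suc K)"
      using Suc.IH[OF le] gauss_weight_pos by (intro mult_right_mono) (auto simp: less_imp_le)
    also have "\<dots> = fps_nth ?B (j - Suc K) * fps_nth (factor 1 n (Suc K)) (Suc K)"
      by (simp add: factor_nth_fermi)
    also have "\<dots> \<le> fps_nth (?B * factor 1 n (Suc K)) (j - Suc K + Suc K)"
      by (intro fps_mult_nth_ge nn)
    also have "j - Suc K + Suc K = j" using \<open>Suc K \<le> j\<close> by simp
    finally show ?thesis unfolding eq .
  qed
qed

text \<open>Each of the K weights is at least exp (- K^2 / (2 * n)). With K near \<delta> * sqrt n
  the total exponent has order \<delta>^3 * sqrt n, which is negligible for small \<delta>.\<close>

lemma small_parts_fermi: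
  assumes "2 * j \<le> K * (K + 1)" "n > 0"
  shows "exp (- (real K ^ 3 / (2 * real n))) \<le> fps_nth (\<Prod>k\<in>{1..K}. factor 1 n k) j"
proof -
  have "exp (- (real K ^ 3 / (2 * real n))) = (\<Prod>k\<in>{1..K}. exp (- (real K ^ 2 / (2 * real n))))"
    by (simp add: power2_eq_square power3_eq_cube flip: exp_of_nat_mult)
  also have "\<dots> \<le> (\<Prod>k\<in>{1..K}. gauss_weight n k)"
    unfolding gauss_weight_def
    by (intro prod_mono) (auto intro!: divide_right_mono power_mono)
  also have "\<dots> \<le> fps_nth (\<Prod>k\<in>{1..K}. factor 1 n k) j"
    by (rule small_parts_fermi_weight[OF assms(1)])
  finally show ?thesis .
qed

subsection \<open>Riemann sums over unbounded intervals\<close>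

text \<open>The sum is the integral of a step function, so dominated convergence applies. The value
  on a cell is taken at its right end y \<ge> x; this is why D x has to bound G at all later points.
  Such a D handles a singularity at 0 and the infinite tail together, for every mesh width.\<close>

lemma riemann_sum_tendsto:
  fixes G D :: "real \<Rightarrow> real" and a b :: "nat \<Rightarrow> nat" and h :: "nat \<Rightarrow> real"
  assumes S: "S \<subseteq> {0<..}" "open S" and cont: "continuous_on S G" and D: "D integrable_on S"
    and bound: "\<And>x y. 0 < x \<Longrightarrow> x \<le> y \<Longrightarrow> \<bar>G y\<bar> \<le> D x"
    and h: "\<And>n. 0 \<le> h n" "h \<longlonglongrightarrow> 0"
    and sub: "\<And>n. {real (a n) * h n<..<real (b n) * h n} \<subseteq> S"
    and ev: "\<And>x. x \<in> S \<Longrightarrow> \<forall>\<^sub>F n in sequentially. real (a n) * h n < x \<and> x \<le> real (b n) * h n"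
  shows "(\<lambda>n. h n * (\<Sum>k\<in>{a n<..b n}. G (real k * h n))) \<longlonglongrightarrow> integral S G"
proof -
  define \<phi> where "\<phi> n x = (\<Sum>k\<in>{a n<..b n}.
    if (real k - 1) * h n < x \<and> x \<le> real k * h n then G (real k * h n) else 0)" for n x
  have int: "(\<phi> n has_integral h n * (\<Sum>k\<in>{a n<..b n}. G (real k * h n))) S" for n
    unfolding \<phi>_def sum_distrib_left
  proof (rule has_integral_sum)
    fix k assume k: "k \<in> {a n<..b n}"
    \<comment> \<open>\<open>sub\<close> places only open intervals inside S; the right end point of
      the cell is added later as a null set.\<close>
    let ?I = "{(real k - 1) * h n<..<real k * h n}" and ?g = "G (real k * h n)"
    have le: "(real k - 1) * h n \<le> real k * h n" using h(1)[of n] by (simp add: algebra_simps)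
    have "((\<lambda>_. ?g) has_integral (real k * h n - (real k - 1) * h n) *\<^sub>R ?g) {(real k - 1) * h n..real k * h n}"
      using has_integral_const_real[of ?g "(real k - 1) * h n" "real k * h n"] le by simp
    then have "((\<lambda>_. ?g) has_integral h n * ?g) ?I"
      by (simp add: has_integral_Icc_iff_Ioo algebra_simps)
    then have "((\<lambda>x. if x \<in> ?I then ?g else 0) has_integral h n * ?g) ?I"
      by (rule has_integral_eq[rotated]) auto
    moreover have "?I \<subseteq> S"
    proof -
      have "real (a n) * h n \<le> (real k - 1) * h n" "real k * h n \<le> real (b n) * h n"
        using k h(1)[of n] by (auto intro!: mult_right_mono)
      then have "?I \<subseteq> {real (a n) * h n<..<real (b n) * h n}" by auto
      then show ?thesis using sub[of n] by blast
    qed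
    ultimately have "((\<lambda>x. if x \<in> ?I then ?g else 0) has_integral h n * ?g) S"
      by (auto intro: has_integral_on_superset)
    then show "((\<lambda>x. if (real k - 1) * h n < x \<and> x \<le> real k * h n then ?g else 0) has_integral
        h n * ?g) S"
      by (rule has_integral_spike_finite[rotated 2, where S = "{real k * h n}"]) auto
  qed auto
  \<comment> \<open>The half-open cells are disjoint, so only the index
    \<open>nat \<lceil>x / h n\<rceil>\<close> can survive.\<close>
  have phi_eq: "\<phi> n x = (if nat \<lceil>x / h n\<rceil> \<in> {a n<..b n} then G (real (nat \<lceil>x / h n\<rceil>) * h n) else 0)"
    if "h n > 0" "x > 0" for n x
  proof -
    have "(real k - 1) * h n < x \<and> x \<le> real k * h n \<longleftrightarrow> k = nat \<lceil>x / h n\<rceil>" for k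
    proof -
      have "(real k - 1) * h n < x \<and> x \<le> real k * h n \<longleftrightarrow> \<lceil>x / h n\<rceil> = int k"
        using that by (simp add: ceiling_eq_iff field_simps)
      also have "\<dots> \<longleftrightarrow> k = nat \<lceil>x / h n\<rceil>"
      proof -
        have "0 < x / h n" using that by simp
        then have "0 < \<lceil>x / h n\<rceil>" by (simp only: zero_less_ceiling)
        then show ?thesis by auto
      qed
      finally show ?thesis .
    qed
    then show ?thesis unfolding \<phi>_def by (simp add: sum.delta)
  qed
  have near: "x \<le> real (nat \<lceil>x / h n\<rceil>) * h n" "real (nat \<lceil>x / h n\<rceil>) * h n \<le> x + h n"
    if "h n > 0" "x > 0" for n x
  proof -
    have "0 < x / h n" using that by simp
    then have "real (nat \<lceil>x / h n\<rceil>) = of_int \<lceil>x / h n\<rceil>" by (simp only: of_nat_nat zero_less_ceiling less_imp_le)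
    moreover have "x / h n \<le> of_int \<lceil>x / h n\<rceil>" "of_int \<lceil>x / h n\<rceil> \<le> x / h n + 1"
      by linarith+
    ultimately show "x \<le> real (nat \<lceil>x / h n\<rceil>) * h n" "real (nat \<lceil>x / h n\<rceil>) * h n \<le> x + h n"
      using that mult_right_mono[of "x / h n" "of_int \<lceil>x / h n\<rceil>" "h n"]
        mult_right_mono[of "of_int \<lceil>x / h n\<rceil>" "x / h n + 1" "h n"]
      by (simp_all add: distrib_right)
  qed
  have "(\<lambda>n. integral S (\<phi> n)) \<longlonglongrightarrow> integral S G"
  proof (rule dominated_convergence)
    show "\<phi> n integrable_on S" for n using int by blast
    show "D integrable_on S" by fact
  next
    fix n x assume "x \<in> S"
    then have x: "x > 0" using S by auto
    have D0: "0 \<le> D x" using bound[OF x order_refl] by linarith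
    show "norm (\<phi> n x) \<le> D x"
    \<comment> \<open>Width 0 occurs in the applications as 1 / sqrt 0; the step function then
      vanishes at x > 0.\<close>
    proof (cases "h n = 0")
      case True
      then show ?thesis using D0 x by (simp add: \<phi>_def)
    next
      case False
      then have "h n > 0" using h(1)[of n] by simp
      then show ?thesis using D0 bound[OF x near(1)] x by (simp add: phi_eq)
    qed
  next
    fix x assume xS: "x \<in> S"
    then have x: "x > 0" using S by auto
    have evx: "\<forall>\<^sub>F n in sequentially. h n > 0 \<and> nat \<lceil>x / h n\<rceil> \<in> {a n<..b n}"
      using ev[OF xS]
    proof eventually_elim
      case (elim n)
      then have hn: "h n > 0" using h(1)[of n] x by (cases "h n = 0") auto
      have "of_int (int (a n)) < x / h n" "x / h n \<le> of_int (int (b n))"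
        using elim hn by (simp_all add: field_simps)
      then have "int (a n) < \<lceil>x / h n\<rceil>" "\<lceil>x / h n\<rceil> \<le> int (b n)"
        by (simp_all only: less_ceiling_iff ceiling_le_iff)
      then show ?case using hn by (simp add: nat_le_iff zless_nat_eq_int_zless)
    qed
    have "(\<lambda>n. real (nat \<lceil>x / h n\<rceil>) * h n) \<longlonglongrightarrow> x"
    proof (rule tendsto_sandwich[where f = "\<lambda>_. x" and h = "\<lambda>n. x + h n"])
      show "\<forall>\<^sub>F n in sequentially. x \<le> real (nat \<lceil>x / h n\<rceil>) * h n"
        using evx by eventually_elim (use near x in auto)
      show "\<forall>\<^sub>F n in sequentially. real (nat \<lceil>x / h n\<rceil>) * h n \<le> x + h n"
        using evx by eventually_elim (use near x in auto)
      show "(\<lambda>n. x + h n) \<longlonglongrightarrow> x" using tendsto_add[OF tendsto_const h(2), of x] by simp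
    qed auto
    moreover have "isCont G x" using cont S(2) xS continuous_on_eq_continuous_at by blast
    ultimately have "(\<lambda>n. G (real (nat \<lceil>x / h n\<rceil>) * h n)) \<longlonglongrightarrow> G x"
      by (rule isCont_tendsto_compose[rotated])
    then show "(\<lambda>n. \<phi> n x) \<longlonglongrightarrow> G x"
    proof (rule Lim_transform_eventually)
      show "\<forall>\<^sub>F n in sequentially. G (real (nat \<lceil>x / h n\<rceil>) * h n) = \<phi> n x"
        using evx by eventually_elim (use x phi_eq in auto)
    qed
  qed
  moreover have "integral S (\<phi> n) = h n * (\<Sum>k\<in>{a n<..b n}. G (real k * h n))" for n
    using int by (rule integral_unique)
  ultimately show ?thesis by simp
qed

lemma integral_truncation_tendsto:
  fixes g :: "real \<Rightarrow> real"
  assumes g: "g absolutely_integrable_on {l<..}" and a: "a \<longlonglongrightarrow> l" "\<And>m. l \<le> a m"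
    and b: "filterlim b at_top sequentially"
  shows "(\<lambda>m::nat. integral {a m<..<b m} g) \<longlonglongrightarrow> integral {l<..} g"
proof -
  define f where "f m x = (if x \<in> {a m<..<b m} then g x else 0)" for m x
  have sub: "{a m<..<b m} \<subseteq> {l<..}" for m using a(2)[of m] by auto
  have f: "f m integrable_on {l<..}" "integral {l<..} (f m) = integral {a m<..<b m} g" for m
  proof -
    have "g absolutely_integrable_on {a m<..<b m}"
      by (rule set_integrable_subset[OF g]) (use sub in auto)
    then have "g integrable_on {a m<..<b m}" by (simp add: absolutely_integrable_on_def)
    then have "f m integrable_on {a m<..<b m}"
      by (rule integrable_eq) (simp add: f_def)
    then show "f m integrable_on {l<..}"
      by (rule integrable_on_superset) (use sub in \<open>auto simp: f_def\<close>)
    show "integral {l<..} (f m) = integral {a m<..<b m} g"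
      unfolding f_def using sub[of m] by (subst integral_restrict_Int) (simp add: Int_absorb2)
  qed
  have "(\<lambda>m. integral {l<..} (f m)) \<longlonglongrightarrow> integral {l<..} g"
  proof (rule dominated_convergence)
    show "(\<lambda>x. norm (g x)) integrable_on {l<..}" using g by (simp add: absolutely_integrable_on_def)
  next
    fix x assume x: "x \<in> {l<..}"
    have "\<forall>\<^sub>F m in sequentially. f m x = g x"
    proof -
      have "\<forall>\<^sub>F m in sequentially. a m < x" using a(1) x by (auto dest: order_tendstoD(2))
      moreover have "\<forall>\<^sub>F m in sequentially. x < b m" using b by (simp add: filterlim_at_top_dense)
      ultimately show ?thesis by eventually_elim (use x in \<open>auto simp: f_def\<close>)
    qed
    then show "(\<lambda>m. f m x) \<longlonglongrightarrow> g x" by (rule tendsto_eventually)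
  qed (use f in \<open>auto simp: f_def\<close>)
  then show ?thesis using f by simp
qed

lemma has_integral_atLeast_iff_greaterThan:
  fixes f :: "real \<Rightarrow> real"
  shows "(f has_integral I) {a..} \<longleftrightarrow> (f has_integral I) {a<..}"
proof (rule has_integral_spike_set_eq)
  show "negligible {x \<in> {a..} - {a<..}. f x \<noteq> 0}" by (rule negligible_subset[of "{a}"]) auto
  show "negligible {x \<in> {a<..} - {a..}. f x \<noteq> 0}" by (rule negligible_subset[of "{}"]) auto
qed

lemma has_integral_exp_minus:
  assumes "\<beta> > (0::real)"
  shows "((\<lambda>x. exp (- \<beta> * x)) has_integral 1 / \<beta>) {0<..}"
proof -
  have "((\<lambda>x. exp (- \<beta> * x)) has_integral exp (- \<beta> * 0) / \<beta>) {0..}"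
    by (rule has_integral_exp_minus_to_infinity[OF assms])
  then have "((\<lambda>x. exp (- \<beta> * x)) has_integral 1 / \<beta>) {0..}" by simp
  then show ?thesis by (simp only: has_integral_atLeast_iff_greaterThan)
qed

text \<open>This is the integrand of the Gamma function at 1/2, with the exponential rescaled by
  \<beta>. It will dominate \<open>log_factor\<close>.\<close>

lemma integrable_inverse_sqrt_exp:
  assumes "\<beta> > (0::real)"
  shows "(\<lambda>x. exp (- \<beta> * x) / sqrt x) integrable_on {0<..}"
proof -
  have "(\<lambda>t. complex_of_real t powr (1 / 2 - 1) / of_real (exp (\<beta> * t))) absolutely_integrable_on {0<..}"
    by (rule absolutely_integrable_Gamma_integral) (use assms in auto)
  then have "(\<lambda>t. norm (complex_of_real t powr (1 / 2 - 1) / of_real (exp (\<beta> * t)))) integrable_on {0<..}"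
    by (simp add: absolutely_integrable_on_def)
  then show ?thesis
  proof (rule integrable_eq)
    fix t :: real assume t: "t \<in> {0<..}"
    have "norm (complex_of_real t powr (1 / 2 - 1)) = t powr (- (1 / 2))"
      using t by (subst norm_powr_real_powr) auto
    then show "norm (complex_of_real t powr (1 / 2 - 1) / of_real (exp (\<beta> * t))) = exp (- \<beta> * t) / sqrt t"
      using t unfolding norm_divide by (simp add: powr_minus powr_half_sqrt exp_minus field_simps)
  qed
qed

lemma absolutely_integrable_if_dominated:
  fixes G D :: "real \<Rightarrow> real"
  assumes "continuous_on {a<..} G" "D integrable_on {a<..}" "\<And>x. x > a \<Longrightarrow> \<bar>G x\<bar> \<le> D x"
  shows "G absolutely_integrable_on {a<..}"
  by (rule measurable_bounded_by_integrable_imp_absolutely_integrable[where g = D])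
    (use assms in \<open>auto intro: continuous_imp_measurable_on_sets_lebesgue\<close>)

subsection \<open>The functions of Bose-Einstein and Fermi-Dirac statistics\<close>

text \<open>At \<open>u = exp (- c / sqrt n)\<close> the factor of the part \<open>k\<close> has the value
  \<open>exp (log_factor \<sigma> c (k / sqrt n))\<close>, and \<open>- x * occupation \<sigma> c x\<close> is the derivative of
  \<open>log_factor \<sigma> c x\<close> with respect to \<open>c\<close>.\<close>

definition log_factor :: "real \<Rightarrow> real \<Rightarrow> real \<Rightarrow> real" where
  "log_factor \<sigma> c x = \<sigma> * ln (1 + \<sigma> * exp (- c * x - x\<^sup>2 / 2))"

definition occupation :: "real \<Rightarrow> real \<Rightarrow> real \<Rightarrow> real" where
  "occupation \<sigma> c x = 1 / (exp (c * x + x\<^sup>2 / 2) + \<sigma>)"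

text \<open>For \<sigma> = -1 and c = 0 the function \<open>x * occupation \<sigma> c x\<close>
  behaves like 2 / x near 0, hence the strict inequality.\<close>

definition admissible :: "real \<Rightarrow> real \<Rightarrow> bool" where
  "admissible \<sigma> c \<longleftrightarrow> \<sigma> = 1 \<or> \<sigma> = -1 \<and> c > 0"

lemma admissible_mono: "admissible \<sigma> c \<Longrightarrow> c \<le> d \<Longrightarrow> admissible \<sigma> d"
  by (auto simp: admissible_def)

lemma admissible_cases:
  assumes "admissible \<sigma> c" "x > 0"
  obtains "\<sigma> = 1" | "\<sigma> = -1" "c > 0" "0 < c * x + x\<^sup>2 / 2" "exp (- c * x - x\<^sup>2 / 2) < 1"
proof -
  have "0 < c * x + x\<^sup>2 / 2" if "c > 0" using that assms(2) by (simp add: add_pos_pos)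
  moreover from this have "exp (- c * x - x\<^sup>2 / 2) < 1" if "c > 0"
    using that by (subst exp_less_one_iff) linarith
  ultimately show ?thesis using assms(1) that unfolding admissible_def by blast
qed

lemma log_factor_occupation_pos:
  assumes "admissible \<sigma> c" "x > 0"
  shows "0 < 1 + \<sigma> * exp (- c * x - x\<^sup>2 / 2)" "0 < exp (c * x + x\<^sup>2 / 2) + \<sigma>" "0 \<le> log_factor \<sigma> c x" "0 < occupation \<sigma> c x"
proof -
  show 1: "0 < 1 + \<sigma> * exp (- c * x - x\<^sup>2 / 2)"
    using assms by (rule admissible_cases) (auto intro: add_pos_pos)
  show 2: "0 < exp (c * x + x\<^sup>2 / 2) + \<sigma>"
    using assms by (rule admissible_cases) (auto intro: add_pos_pos)
  show "0 \<le> log_factor \<sigma> c x"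
    using assms by (rule admissible_cases) (auto simp: log_factor_def)
  show "0 < occupation \<sigma> c x" using 2 by (simp add: occupation_def)
qed

lemma continuous_on_log_factor: "admissible \<sigma> c \<Longrightarrow> S \<subseteq> {0<..} \<Longrightarrow> continuous_on S (log_factor \<sigma> c)"
  unfolding log_factor_def
  by (intro continuous_on_mult continuous_on_ln continuous_on_add continuous_on_exp continuous_on_diff
      continuous_on_divide continuous_on_power continuous_on_const continuous_on_id ballI
      less_imp_neq[THEN not_sym] log_factor_occupation_pos(1)) auto

lemma continuous_on_occupation: "admissible \<sigma> c \<Longrightarrow> S \<subseteq> {0<..} \<Longrightarrow> continuous_on S (occupation \<sigma> c)"
  unfolding occupation_def
  by (intro continuous_on_divide continuous_on_add continuous_on_exp continuous_on_mult
      continuous_on_power continuous_on_const continuous_on_id ballI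
      less_imp_neq[THEN not_sym] log_factor_occupation_pos(2)) auto

lemma occupation_antimono:
  assumes "admissible \<sigma> c" "c \<le> d" "x > 0"
  shows "occupation \<sigma> d x \<le> occupation \<sigma> c x"
  unfolding occupation_def using assms log_factor_occupation_pos(2)[OF assms(1,3)]
  by (intro divide_left_mono mult_pos_pos log_factor_occupation_pos(2)[OF admissible_mono]) auto

lemma occupation_strict_antimono:
  assumes "admissible \<sigma> c" "c < d" "x > 0"
  shows "occupation \<sigma> d x < occupation \<sigma> c x"
  unfolding occupation_def using assms log_factor_occupation_pos(2)[OF assms(1,3)]
  by (intro divide_strict_left_mono mult_pos_pos log_factor_occupation_pos(2)[OF admissible_mono]) auto

text \<open>Splitting exp y - 1 as a difference of squares keeps both the linear zero at 0 and
  exponential growth, so a single bound serves near 0 and at infinity.\<close>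

lemma exp_minus_one_ge:
  assumes "y \<ge> (0::real)"
  shows "y / 2 * exp (y / 2) \<le> exp y - 1"
proof -
  have "y / 2 * exp (y / 2) \<le> (exp (y / 2) - 1) * (exp (y / 2) + 1)"
  proof (intro mult_mono)
    show "y / 2 \<le> exp (y / 2) - 1" using exp_ge_add_one_self[of "y / 2"] by linarith
  qed (use assms in auto)
  also have "\<dots> = exp y - 1" by (simp add: algebra_simps flip: exp_add)
  finally show ?thesis .
qed

lemma exp_neg_exponent: "exp (- c * x - x\<^sup>2 / 2) = 1 / exp (c * x + (x::real)\<^sup>2 / 2)"
proof -
  have "- c * x - x\<^sup>2 / 2 = - (c * x + x\<^sup>2 / 2)" by simp
  then show ?thesis by (simp only: exp_minus inverse_eq_divide)
qed

text \<open>Completing the square. The slope a is arbitrary, so exponential decay is available even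
  for negative c.\<close>

lemma gaussian_le_exp: "exp (- c * x - x\<^sup>2 / 2) \<le> exp ((a - c)\<^sup>2 / 2) * exp (- a * (x::real))"
proof -
  have "0 \<le> (a - c - x)\<^sup>2" by simp
  then have "- c * x - x\<^sup>2 / 2 \<le> (a - c)\<^sup>2 / 2 + - a * x"
    by (simp add: power2_eq_square algebra_simps)
  then show ?thesis by (simp flip: exp_add)
qed

text \<open>The factor x cancels the simple pole that the Bose occupation has at 0; the Fermi
  occupation is smaller than the Bose one.\<close>

lemma x_occupation_le_exp:
  assumes "c > 0" "x > 0" "\<sigma> = 1 \<or> \<sigma> = -1"
  shows "x * occupation \<sigma> c x \<le> 2 / c * exp (- (c / 2) * x)"
proof -
  have pos: "0 < c * x / 2 * exp (c * x / 2)" using assms by simp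
  have "c * x / 2 * exp (c * x / 2) \<le> exp (c * x) - 1"
    using assms by (intro exp_minus_one_ge) auto
  also have "\<dots> \<le> exp (c * x + x\<^sup>2 / 2) + \<sigma>" 
  proof -
    have "exp (c * x) \<le> exp (c * x + x\<^sup>2 / 2)" by simp
    then show ?thesis using assms(3) by linarith
  qed
  finally have "x * occupation \<sigma> c x \<le> x * (1 / (c * x / 2 * exp (c * x / 2)))"
    unfolding occupation_def using pos assms
    by (intro mult_left_mono divide_left_mono mult_pos_pos[of "exp (c * x + x\<^sup>2 / 2) + \<sigma>"]) linarith+
  also have "\<dots> = 2 / c * exp (- (c / 2) * x)"
    using assms by (simp add: exp_minus field_simps)
  finally show ?thesis .
qed

lemma x_occupation_bound:
  assumes "admissible \<sigma> c"
  obtains C \<beta> where "C > 0" "\<beta> > 0" "\<And>x. x > 0 \<Longrightarrow> x * occupation \<sigma> c x \<le> C * exp (- \<beta> * x)"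
proof (cases "\<sigma> = 1")
  case True
  show ?thesis
  \<comment> \<open>Slope 2 leaves decay of rate 1 after one factor exp x has absorbed x.\<close>
  proof (rule that[of "exp ((2 - c)\<^sup>2 / 2)" 1])
    fix x :: real assume x: "x > 0"
    have "occupation \<sigma> c x \<le> 1 / exp (c * x + x\<^sup>2 / 2)"
      unfolding occupation_def True by (intro divide_left_mono mult_pos_pos add_pos_pos) auto
    also have "\<dots> = exp (- c * x - x\<^sup>2 / 2)" by (simp only: exp_neg_exponent)
    also have "\<dots> \<le> exp ((2 - c)\<^sup>2 / 2) * exp (- 2 * x)" by (rule gaussian_le_exp)
    finally have "x * occupation \<sigma> c x \<le> exp x * (exp ((2 - c)\<^sup>2 / 2) * exp (- 2 * x))"
      using x exp_ge_add_one_self[of x] log_factor_occupation_pos(4)[OF assms x] by (intro mult_mono) linarith+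
    also have "\<dots> = exp ((2 - c)\<^sup>2 / 2) * exp (- 1 * x)"
      by (simp add: mult.left_commute flip: exp_add)
    finally show "x * occupation \<sigma> c x \<le> exp ((2 - c)\<^sup>2 / 2) * exp (- 1 * x)" .
  qed auto
next
  case False
  then have "\<sigma> = -1" "c > 0" using assms by (auto simp: admissible_def)
  then show ?thesis using x_occupation_le_exp[of c _ \<sigma>] by (intro that[of "2 / c" "c / 2"]) auto
qed

text \<open>The majorant is decreasing, as the Riemann sum argument requires, and 1 / sqrt x absorbs
  the logarithmic singularity of the Bose case.\<close>

lemma log_factor_bound:
  assumes "admissible \<sigma> c"
  obtains C \<beta> where "C > 0" "\<beta> > 0" "\<And>x. x > 0 \<Longrightarrow> log_factor \<sigma> c x \<le> C * (exp (- \<beta> * x) / sqrt x)"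
proof (cases "\<sigma> = 1")
  case True
  show ?thesis
  proof (rule that[of "exp ((2 - c)\<^sup>2 / 2)" 1])
    fix x :: real assume x: "x > 0"
    have "sqrt x \<le> exp x"
    proof (rule real_le_lsqrt)
      have "x \<le> exp (2 * x)" using exp_ge_add_one_self[of "2 * x"] x by linarith
      then show "x \<le> (exp x)\<^sup>2" by (simp add: exp_double)
    qed (use x in auto)
    have "log_factor \<sigma> c x \<le> exp (- c * x - x\<^sup>2 / 2)"
      unfolding log_factor_def True using ln_add_one_self_le_self[of "exp (- c * x - x\<^sup>2 / 2)"] by simp
    also have "\<dots> \<le> exp ((2 - c)\<^sup>2 / 2) * exp (- 2 * x)" by (rule gaussian_le_exp)
    also have "exp (- 2 * x) = exp (- 1 * x) / exp x" by (simp flip: exp_diff)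
    also have "\<dots> \<le> exp (- 1 * x) / sqrt x"
      using x \<open>sqrt x \<le> exp x\<close> by (intro divide_left_mono) auto
    finally show "log_factor \<sigma> c x \<le> exp ((2 - c)\<^sup>2 / 2) * (exp (- 1 * x) / sqrt x)" by simp
  qed auto
next
  case False
  then have \<sigma>: "\<sigma> = -1" and c: "c > 0" using assms by (auto simp: admissible_def)
  show ?thesis
  proof (rule that[of "2 * sqrt (2 / c)" "c / 4"])
    fix x :: real assume x: "x > 0"
    \<comment> \<open>In terms of t the logarithm is ln (1 + 1 / t), and t vanishes linearly at
      0.\<close>
    define t where "t = exp (c * x + x\<^sup>2 / 2) - 1"
    have "c * x / 2 * exp (c * x / 2) \<le> exp (c * x) - 1"
      using c x by (intro exp_minus_one_ge) auto
    also have "\<dots> \<le> t" by (simp add: t_def)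
    finally have t: "c * x / 2 * exp (c * x / 2) \<le> t" .
    have pos: "0 < c * x / 2 * exp (c * x / 2)" using c x by simp
    then have "t > 0" using t by linarith
    have "exp (- c * x - x\<^sup>2 / 2) = 1 / (1 + t)"
      unfolding exp_neg_exponent by (simp add: t_def)
    then have "log_factor \<sigma> c x = - ln (1 - 1 / (1 + t))" by (simp add: log_factor_def \<sigma>)
    also have "1 - 1 / (1 + t) = inverse (1 + 1 / t)" using \<open>t > 0\<close> by (simp add: field_simps)
    also have "- ln \<dots> = ln (1 + 1 / t)" using \<open>t > 0\<close> by (simp add: ln_inverse)
    \<comment> \<open>Using ln (1 + 1 / t) \<le> 1 / t would give a nonintegrable 1 / x. Extracting
      a square first gives 2 / sqrt t instead.\<close>
    also have "\<dots> \<le> ln ((1 + sqrt (1 / t))\<^sup>2)"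
    proof (rule ln_mono)
      have "(1 + sqrt (1 / t))\<^sup>2 = 1 + 2 * sqrt (1 / t) + 1 / t"
        unfolding power2_sum using \<open>t > 0\<close> by simp
      then show "1 + 1 / t \<le> (1 + sqrt (1 / t))\<^sup>2" using \<open>t > 0\<close> by simp
      show "0 < 1 + 1 / t" using \<open>t > 0\<close> by (intro add_pos_pos) auto
    qed
    also have "\<dots> = 2 * ln (1 + sqrt (1 / t))" using \<open>t > 0\<close> by (subst ln_realpow) (auto intro: add_pos_nonneg)
    also have "\<dots> \<le> 2 * sqrt (1 / t)" using \<open>t > 0\<close> ln_add_one_self_le_self[of "sqrt (1 / t)"] by simp
    also have "\<dots> \<le> 2 * sqrt (1 / (c * x / 2 * exp (c * x / 2)))"
      using pos t \<open>t > 0\<close>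
      by (intro mult_left_mono real_sqrt_le_mono divide_left_mono mult_pos_pos[of t]) linarith+
    also have "1 / (c * x / 2 * exp (c * x / 2)) = 2 / c * ((exp (- (c / 4) * x))\<^sup>2 / x)"
    proof -
      have "exp (- (c / 4) * x) * exp (- (c / 4) * x) * exp (c * x / 2) = 1"
        by (simp flip: exp_add)
      then show ?thesis using c x by (simp add: power2_eq_square field_simps)
    qed
    also have "2 * sqrt \<dots> = 2 * sqrt (2 / c) * (exp (- (c / 4) * x) / sqrt x)"
      by (simp add: real_sqrt_mult real_sqrt_divide)
    finally show "log_factor \<sigma> c x \<le> 2 * sqrt (2 / c) * (exp (- (c / 4) * x) / sqrt x)" .
  qed (use c in auto)
qed

text \<open>Convexity in c: the graph lies above its tangent, whose slope is
  \<open>- (x * occupation \<sigma> c x)\<close>. This will convert a change of tilt into a bound by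
  the mean size at the new tilt.\<close>

lemma log_factor_above_tangent:
  assumes "admissible \<sigma> c" "admissible \<sigma> d" "x > 0"
  shows "log_factor \<sigma> c x + (c - d) * (x * occupation \<sigma> c x) \<le> log_factor \<sigma> d x"
proof -
  have conv: "convex {c. admissible \<sigma> c}"
  proof (cases "\<sigma> = 1")
    case False
    then have "{c. admissible \<sigma> c} = (if \<sigma> = -1 then {0<..} else {})" by (auto simp: admissible_def)
    then show ?thesis by simp
  qed (simp add: admissible_def)
  have d1: "((\<lambda>c. log_factor \<sigma> c x) has_real_derivative - (x * occupation \<sigma> c x)) (at c)" if "admissible \<sigma> c" for c
  proof -
    define E where "E = exp (c * x + x\<^sup>2 / 2)"
    have E: "exp (- c * x - x\<^sup>2 / 2) = 1 / E" "E > 0" "E + \<sigma> > 0" "1 + \<sigma> / E > 0"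
      using log_factor_occupation_pos(1,2)[OF that assms(3)] unfolding exp_neg_exponent E_def by auto
    have \<sigma>: "\<sigma> * \<sigma> = 1" using that by (auto simp: admissible_def)
    have "((\<lambda>c. log_factor \<sigma> c x) has_real_derivative
        \<sigma> * (\<sigma> * (exp (- c * x - x\<^sup>2 / 2) * (- x)) / (1 + \<sigma> * exp (- c * x - x\<^sup>2 / 2)))) (at c)"
      unfolding log_factor_def using log_factor_occupation_pos(1)[OF that assms(3)] by (auto intro!: derivative_eq_intros)
    also have "\<sigma> * (\<sigma> * (exp (- c * x - x\<^sup>2 / 2) * (- x)) / (1 + \<sigma> * exp (- c * x - x\<^sup>2 / 2))) =
        - (\<sigma> * \<sigma> * x / (E * (1 + \<sigma> / E)))"
      unfolding E(1) using E(2) by simp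
    also have "\<dots> = - (x * occupation \<sigma> c x)"
      unfolding \<sigma> occupation_def E_def[symmetric] using E by (simp add: algebra_simps)
    finally show ?thesis .
  qed
  \<comment> \<open>The second derivative is the variance of x times the occupation number, hence
    nonnegative.\<close>
  have d2: "((\<lambda>c. - (x * occupation \<sigma> c x)) has_real_derivative
      x\<^sup>2 * exp (c * x + x\<^sup>2 / 2) / (exp (c * x + x\<^sup>2 / 2) + \<sigma>)\<^sup>2) (at c)" if "admissible \<sigma> c" for c
    unfolding occupation_def using log_factor_occupation_pos(2)[OF that assms(3)]
    by (auto intro!: derivative_eq_intros simp: power2_eq_square)
  have "- (x * occupation \<sigma> c x) * (d - c) \<le> log_factor \<sigma> d x - log_factor \<sigma> c x"
    by (rule f''_imp_f'[OF conv d1 d2]) (use assms in auto)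
  then show ?thesis by (simp add: algebra_simps)
qed

lemma absolutely_integrable_log_factor:
  assumes "admissible \<sigma> c"
  shows "log_factor \<sigma> c absolutely_integrable_on {0<..}"
proof -
  obtain C \<beta> where C: "C > 0" "\<beta> > 0" "\<And>x. x > 0 \<Longrightarrow> log_factor \<sigma> c x \<le> C * (exp (- \<beta> * x) / sqrt x)"
    using log_factor_bound[OF assms] by metis
  show ?thesis
  proof (rule absolutely_integrable_if_dominated[where D = "\<lambda>x. C * (exp (- \<beta> * x) / sqrt x)"])
    show "(\<lambda>x. C * (exp (- \<beta> * x) / sqrt x)) integrable_on {0<..}"
      by (intro integrable_on_mult_right integrable_inverse_sqrt_exp C)
    show "\<bar>log_factor \<sigma> c x\<bar> \<le> C * (exp (- \<beta> * x) / sqrt x)" if "x > 0" for x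
      using C(3)[OF that] log_factor_occupation_pos(3)[OF assms that] by simp
  qed (auto intro!: continuous_on_log_factor assms)
qed

lemma absolutely_integrable_x_occupation:
  assumes "admissible \<sigma> c"
  shows "(\<lambda>x. x * occupation \<sigma> c x) absolutely_integrable_on {0<..}"
proof -
  obtain C \<beta> where C: "C > 0" "\<beta> > 0" "\<And>x. x > 0 \<Longrightarrow> x * occupation \<sigma> c x \<le> C * exp (- \<beta> * x)"
    using x_occupation_bound[OF assms] by metis
  show ?thesis
  proof (rule absolutely_integrable_if_dominated[where D = "\<lambda>x. C * exp (- \<beta> * x)"])
    show "(\<lambda>x. C * exp (- \<beta> * x)) integrable_on {0<..}"
      using has_integral_exp_minus[OF C(2)] by (intro integrable_on_mult_right) blast
    show "\<bar>x * occupation \<sigma> c x\<bar> \<le> C * exp (- \<beta> * x)" if "x > 0" for x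
      using C(3)[OF that] log_factor_occupation_pos(4)[OF assms that] that by simp
  qed (auto intro!: continuous_on_mult continuous_on_id continuous_on_occupation assms)
qed

lemma integrable_Ioo_if_absolutely_integrable:
  fixes g :: "real \<Rightarrow> real"
  assumes "g absolutely_integrable_on {l<..}" "l \<le> a"
  shows "g integrable_on {a<..<b}" "g integrable_on {a<..}"
proof -
  have "g absolutely_integrable_on {a<..<b}" "g absolutely_integrable_on {a<..}"
    by (rule set_integrable_subset[OF assms(1)]; use assms(2) in auto)+
  then show "g integrable_on {a<..<b}" "g integrable_on {a<..}"
    by (simp_all add: absolutely_integrable_on_def)
qed

text \<open>The occupation decreases in c, so its value at c0 dominates all the others. The set S is
  kept general to cover both the half-line and the truncated interval.\<close>

lemma continuous_on_integral_x_occupation: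
  assumes c0: "admissible \<sigma> c0" and S: "S \<subseteq> {0<..}"
    and int: "\<And>c. c \<ge> c0 \<Longrightarrow> (\<lambda>x. x * occupation \<sigma> c x) integrable_on S"
  shows "continuous_on {c0..} (\<lambda>c. integral S (\<lambda>x. x * occupation \<sigma> c x))"
  unfolding continuous_on_sequentially comp_def
proof (intro allI ballI impI)
  fix u c assume "c \<in> {c0..}" and u: "(\<forall>n::nat. u n \<in> {c0..}) \<and> u \<longlonglongrightarrow> c"
  then have c: "c \<ge> c0" and un: "u n \<ge> c0" for n by auto
  show "(\<lambda>n. integral S (\<lambda>x. x * occupation \<sigma> (u n) x)) \<longlonglongrightarrow> integral S (\<lambda>x. x * occupation \<sigma> c x)"
  proof (rule dominated_convergence[where h = "\<lambda>x. x * occupation \<sigma> c0 x"])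
    fix n x assume "x \<in> S"
    then have x: "x > 0" using S by auto
    then show "norm (x * occupation \<sigma> (u n) x) \<le> x * occupation \<sigma> c0 x"
      using occupation_antimono[OF c0 un x] log_factor_occupation_pos(4)[OF admissible_mono[OF c0 un] x, of n] by simp
  next
    fix x assume "x \<in> S"
    then have x: "x > 0" using S by auto
    show "(\<lambda>n. x * occupation \<sigma> (u n) x) \<longlonglongrightarrow> x * occupation \<sigma> c x"
      unfolding occupation_def using u log_factor_occupation_pos(2)[OF admissible_mono[OF c0 c] x]
      by (intro tendsto_intros) auto
  qed (use int un in auto)
qed

lemma integral_pos:
  fixes g :: "real \<Rightarrow> real"
  assumes "g integrable_on S" "\<And>x. x \<in> S \<Longrightarrow> 0 \<le> g x" "a < b" "{a..b} \<subseteq> S" "continuous_on {a..b} g"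
    "\<And>x. x \<in> {a<..<b} \<Longrightarrow> 0 < g x"
  shows "0 < integral S g"
proof -
  have "integral {a..b} (\<lambda>_. 0) < integral {a..b} g"
    using assms by (intro integral_less_real) auto
  also have "\<dots> \<le> integral S g"
    using assms by (intro integral_subset_le integrable_on_subinterval[OF assms(1)]) auto
  finally show ?thesis by simp
qed

section \<open>The mean size and the equations for the tilt\<close>

definition mean_size :: "real \<Rightarrow> real \<Rightarrow> real" where
  "mean_size \<sigma> c = integral {0<..} (\<lambda>x. x * occupation \<sigma> c x)"

lemma has_integral_mean_size:
  assumes "admissible \<sigma> c"
  shows "((\<lambda>x. x * occupation \<sigma> c x) has_integral mean_size \<sigma> c) {0<..}"
  using absolutely_integrable_x_occupation[OF assms]
  unfolding mean_size_def absolutely_integrable_on_def by (blast intro: integrable_integral)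

lemma mean_size_strict_antimono:
  assumes "admissible \<sigma> c" "c < d"
  shows "mean_size \<sigma> d < mean_size \<sigma> c"
proof -
  have d: "admissible \<sigma> d" using assms admissible_mono by auto
  let ?g = "\<lambda>x. x * occupation \<sigma> c x - x * occupation \<sigma> d x"
  have g: "(?g has_integral mean_size \<sigma> c - mean_size \<sigma> d) {0<..}"
    by (intro has_integral_diff has_integral_mean_size assms d)
  have pos: "0 < ?g x" if "x > 0" for x
    using occupation_strict_antimono[OF assms that] that by simp
  have "0 < integral {0<..} ?g"
  proof (rule integral_pos[where a = 1 and b = 2])
    show "continuous_on {1..2} ?g"
      using assms d by (intro continuous_intros continuous_on_occupation) auto
    show "?g integrable_on {0<..}" using g by blast
    show "0 \<le> ?g x" if "x \<in> {0<..}" for x using pos[of x] that by (simp only: greaterThan_iff less_imp_le)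
    show "0 < ?g x" if "x \<in> {1<..<2}" for x using that by (intro pos) auto
  qed auto
  then show ?thesis using integral_unique[OF g] by simp
qed

lemma mean_size_le:
  assumes "c > 0" "\<sigma> = 1 \<or> \<sigma> = -1"
  shows "mean_size \<sigma> c \<le> 4 / c\<^sup>2"
proof (rule has_integral_le)
  show "((\<lambda>x. x * occupation \<sigma> c x) has_integral mean_size \<sigma> c) {0<..}"
    using assms by (intro has_integral_mean_size) (auto simp: admissible_def)
  show "((\<lambda>x. 2 / c * exp (- (c / 2) * x)) has_integral 4 / c\<^sup>2) {0<..}"
    using has_integral_mult_right[OF has_integral_exp_minus[of "c / 2"], of "2 / c"] assms
    by (simp add: power2_eq_square)
  show "x * occupation \<sigma> c x \<le> 2 / c * exp (- (c / 2) * x)" if "x \<in> {0<..}" for x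
    using x_occupation_le_exp[of c x \<sigma>] assms that by simp
qed

lemma mean_size_ge:
  assumes "admissible \<sigma> c" "(g has_integral I) {0..b}"
    "\<And>x. 0 < x \<Longrightarrow> x < b \<Longrightarrow> g x \<le> x * occupation \<sigma> c x"
  shows "I \<le> mean_size \<sigma> c"
proof -
  have int: "(\<lambda>x. x * occupation \<sigma> c x) integrable_on {0<..<b}"
    using absolutely_integrable_x_occupation[OF assms(1)] by (rule integrable_Ioo_if_absolutely_integrable) simp
  have "I \<le> integral {0<..<b} (\<lambda>x. x * occupation \<sigma> c x)"
    by (rule has_integral_le[OF _ integrable_integral[OF int]])
      (use assms in \<open>auto simp: has_integral_Icc_iff_Ioo\<close>)
  also have "\<dots> \<le> mean_size \<sigma> c"
    unfolding mean_size_def using int has_integral_mean_size[OF assms(1)] log_factor_occupation_pos(4)[OF assms(1)]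
    by (intro integral_subset_le) (auto simp: less_imp_le)
  finally show ?thesis .
qed

text \<open>At c = 1/10 the exponent y is x * (x + 1/5) / 2 and stays below 1 on (0, 1), where exp y
  - 1 \<le> 2 * y. The integrand is thus at least 1 / (x + 1/5), with integral ln 6 \<ge> 1.\<close>

lemma mean_size_bose_ge: "1 \<le> mean_size (-1) (1 / 10)"
proof -
  have "((\<lambda>x::real. 1 / (x + 1 / 5)) has_integral ln (1 + 1 / 5) - ln (0 + 1 / 5)) {0..1}"
    by (rule fundamental_theorem_of_calculus)
      (auto intro!: derivative_eq_intros simp flip: has_real_derivative_iff_has_vector_derivative)
  moreover have "1 / (x + 1 / 5) \<le> x * occupation (-1) (1 / 10) x" if "0 < x" "x < 1" for x :: real
  proof -
    define y where "y = 1 / 10 * x + x\<^sup>2 / 2"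
    have "x\<^sup>2 \<le> 1" using that by (simp add: power_le_one)
    then have y: "0 < y" "y \<le> 1" using that by (auto simp: y_def add_pos_pos)
    have "exp y \<le> 1 + y + y\<^sup>2" using y by (intro exp_bound) auto
    also have "y\<^sup>2 \<le> y" using y by (simp add: power2_eq_square mult_left_le)
    finally have "exp y - 1 \<le> 2 * y" by simp
    moreover have "0 < exp y - 1" using y by simp
    ultimately have "x / (2 * y) \<le> x / (exp y - 1)"
      using that by (intro divide_left_mono) (auto intro: mult_pos_pos)
    also have "2 * y = x * (x + 1 / 5)" by (simp add: y_def power2_eq_square field_simps)
    also have "x / \<dots> = 1 / (x + 1 / 5)" using that by simp
    finally show ?thesis by (simp add: occupation_def y_def)
  qed
  ultimately have "ln (1 + 1 / 5) - ln (0 + 1 / 5) \<le> mean_size (-1) (1 / 10)"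
    by (rule mean_size_ge[rotated]) (auto simp: admissible_def)
  moreover have "(1::real) \<le> ln 6" using exp_le by (subst ln_ge_iff) auto
  moreover have "ln (1 + 1 / 5) - ln (0 + 1 / 5) = ln (6::real)"
    using ln_div[of "6 / 5 :: real" "1 / 5"] by simp
  ultimately show ?thesis by linarith
qed

text \<open>At c = -1 the exponent is nonpositive on (0, 2), so the occupation is at least 1/2
  there, and x / 2 has integral 1.\<close>

lemma mean_size_fermi_ge: "1 \<le> mean_size 1 (-1)"
proof -
  have "((\<lambda>x::real. x / 2) has_integral 2\<^sup>2 / 4 - 0\<^sup>2 / 4) {0..2}"
    by (rule fundamental_theorem_of_calculus)
      (auto intro!: derivative_eq_intros simp flip: has_real_derivative_iff_has_vector_derivative)
  moreover have "x / 2 \<le> x * occupation 1 (-1) x" if "0 < x" "x < 2" for x :: real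
  proof -
    have "- 1 * x + x\<^sup>2 / 2 \<le> 0" using that by (simp add: power2_eq_square)
    then have "exp (- 1 * x + x\<^sup>2 / 2) \<le> 1" by simp
    then have "x / 2 \<le> x / (exp (- 1 * x + x\<^sup>2 / 2) + 1)"
      using that by (intro divide_left_mono mult_pos_pos add_pos_pos) auto
    then show ?thesis by (simp add: occupation_def)
  qed
  ultimately have "2\<^sup>2 / 4 - 0\<^sup>2 / 4 \<le> mean_size 1 (-1)"
    by (rule mean_size_ge[rotated]) (auto simp: admissible_def)
  then show ?thesis by simp
qed

text \<open>Intermediate value theorem on [l, 2]: the bound 4 / c^2 equals 1 at c = 2, and l comes
  from the two explicit estimates. Strict monotonicity gives uniqueness.\<close>

lemma ex1_mean_size_eq_1:
  assumes "\<sigma> = 1 \<or> \<sigma> = -1"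
  shows "\<exists>!c. admissible \<sigma> c \<and> mean_size \<sigma> c = 1"
proof (rule ex_ex1I)
  obtain l where l: "admissible \<sigma> l" "l \<le> 2" "1 \<le> mean_size \<sigma> l"
  proof (cases "\<sigma> = 1")
    case True
    then show ?thesis using that[of "-1"] mean_size_fermi_ge by (simp add: admissible_def)
  next
    case False
    then show ?thesis using that[of "1 / 10"] assms mean_size_bose_ge by (simp add: admissible_def)
  qed
  have "continuous_on {l..} (mean_size \<sigma>)"
    unfolding mean_size_def[abs_def]
  proof (rule continuous_on_integral_x_occupation[OF l(1) order_refl])
    fix c assume "l \<le> c"
    then have "admissible \<sigma> c" by (rule admissible_mono[OF l(1)])
    then show "(\<lambda>x. x * occupation \<sigma> c x) integrable_on {0<..}"
      using has_integral_mean_size by blast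
  qed
  then have "continuous_on {l..2} (mean_size \<sigma>)" by (rule continuous_on_subset) auto
  moreover have "mean_size \<sigma> 2 \<le> 1" using mean_size_le[of 2 \<sigma>] assms by simp
  ultimately obtain c where "c \<ge> l" "mean_size \<sigma> c = 1"
    using IVT2'[of "mean_size \<sigma>" 2 1 l, OF _ l(3,2)] by blast
  then show "\<exists>c. admissible \<sigma> c \<and> mean_size \<sigma> c = 1" using admissible_mono[OF l(1)] by blast
next
  fix c d assume "admissible \<sigma> c \<and> mean_size \<sigma> c = 1" "admissible \<sigma> d \<and> mean_size \<sigma> d = 1"
  then show "c = d" using mean_size_strict_antimono[of \<sigma> c d] mean_size_strict_antimono[of \<sigma> d c]
    using less_linear[of c d] by auto
qed

text \<open>For \<open>c \<le> 0\<close> the Bose integrand behaves like a multiple of \<open>1 / (x - x0)\<close> to the right of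
  the zero \<open>x0 = - 2 * c\<close> of the exponent.\<close>

lemma bose_eq_imp_pos:
  assumes "bose_eq c"
  shows "c > 0"
proof (rule ccontr)
  assume "\<not> c > 0"
  define x0 where "x0 = - 2 * c"
  have x0: "x0 \<ge> 0" using \<open>\<not> c > 0\<close> by (simp add: x0_def)
  define f where "f x = x / (exp (c * x + x\<^sup>2 / 2) - 1)" for x :: real
  have f: "f integrable_on {0..}" using assms by (auto simp: bose_eq_def f_def[abs_def])
  \<comment> \<open>Integrability passes to subintervals, so negative values left of x0 cannot
    compensate the divergence on its right.\<close>
  have int: "f integrable_on {a..b}" if "0 \<le> a" for a b
    using f by (rule integrable_on_subinterval) (use that in auto)
  have arg: "c * x + x\<^sup>2 / 2 = x * (x - x0) / 2" for x
    by (simp add: x0_def power2_eq_square field_simps)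
  \<comment> \<open>With y = x * (x - x0) / 2, exp y - 1 \<le> y * exp y bounds the integrand below
    by 2 * exp (- y) / (x - x0), and y \<le> (x0 + 1) / 2 on the interval considered.\<close>
  define m where "m = 2 * exp (- ((x0 + 1) / 2))"
  have m: "m > 0" by (simp add: m_def)
  have ge: "m * (1 / (x - x0)) \<le> f x" if "x0 < x" "x \<le> x0 + 1" for x
  proof -
    define y where "y = x * (x - x0) / 2"
    have x: "x > 0" using that x0 by linarith
    have y: "0 < y" using that x by (simp add: y_def)
    have "x * (x - x0) \<le> (x0 + 1) * 1" using that x x0 by (intro mult_mono) auto
    then have y1: "y \<le> (x0 + 1) / 2" by (simp add: y_def)
    have "exp y * (1 - y) \<le> exp y * exp (- y)" using exp_ge_add_one_self[of "- y"] by (intro mult_left_mono) auto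
    then have "exp y - 1 \<le> y * exp y" by (simp add: exp_minus field_simps)
    then have le: "x / (y * exp y) \<le> x / (exp y - 1)"
      using x y by (intro divide_left_mono mult_pos_pos) auto
    have "m * (1 / (x - x0)) \<le> 2 * exp (- y) * (1 / (x - x0))"
      unfolding m_def using that y1 by (intro mult_right_mono mult_left_mono) auto
    also have "\<dots> = x / (y * exp y)" using that x by (simp add: y_def exp_minus field_simps)
    also note le
    finally show ?thesis by (simp add: f_def arg y_def)
  qed
  have nonneg: "0 \<le> f x" if "x0 \<le> x" "x \<le> x0 + 1" for x
  proof (cases "x = x0")
    \<comment> \<open>The denominator is 0 at x0, and division by 0 gives 0.\<close>
    case True
    then show ?thesis by (simp add: f_def arg)
  next
    case False
    then have "0 \<le> m * (1 / (x - x0))" using that m by simp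
    then show ?thesis using ge[of x] that False by simp
  qed
  define A where "A = integral {x0..x0 + 1} f"
  have A: "0 \<le> A" unfolding A_def by (rule integral_nonneg) (use int x0 nonneg in auto)
  \<comment> \<open>The minorant m / (x - x0) has integral m * t from x0 + exp (- t) to x0 + 1; this
    t makes it A + m, more than the whole integral A.\<close>
  define t where "t = A / m + 1"
  have t: "t > 0" unfolding t_def using A m by (intro add_nonneg_pos divide_nonneg_pos) auto
  have e: "0 < exp (- t)" "exp (- t) < 1" using t by auto
  have "((\<lambda>x. m * (1 / (x - x0))) has_integral m * (ln (x0 + 1 - x0) - ln (x0 + exp (- t) - x0)))
      {x0 + exp (- t)..x0 + 1}"
    by (intro has_integral_mult_right fundamental_theorem_of_calculus)
      (use e in \<open>auto intro!: derivative_eq_intros add_pos_nonneg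
        simp flip: has_real_derivative_iff_has_vector_derivative
        intro: less_le_trans[of 0 "exp (- t)"]\<close>)
  then have "m * (ln (x0 + 1 - x0) - ln (x0 + exp (- t) - x0)) \<le> integral {x0 + exp (- t)..x0 + 1} f"
    by (rule has_integral_le[OF _ integrable_integral[OF int]])
      (use x0 e in \<open>auto intro!: ge[unfolded times_divide_eq_right mult_1_right] intro: less_le_trans[of _ "x0 + exp (- t)"]\<close>)
  also have "\<dots> \<le> A" unfolding A_def
    by (intro integral_subset_le int ballI) (use x0 e nonneg in auto)
  finally have "m * t \<le> A" by simp
  moreover have "m * t = A + m" using m by (simp add: t_def distrib_left)
  ultimately show False using m by linarith
qed

lemma bose_eq_iff: "bose_eq c \<longleftrightarrow> admissible (-1) c \<and> mean_size (-1) c = 1"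
proof -
  have "bose_eq c \<longleftrightarrow> ((\<lambda>x. x * occupation (-1) c x) has_integral 1) {0<..}"
    by (simp add: bose_eq_def occupation_def has_integral_atLeast_iff_greaterThan)
  then show ?thesis
    using bose_eq_imp_pos[of c] has_integral_mean_size[of "-1" c] has_integral_unique[of _ 1 "{0<..}" "mean_size (-1) c"]
    by (auto simp: admissible_def)
qed

lemma fermi_eq_iff: "fermi_eq c \<longleftrightarrow> admissible 1 c \<and> mean_size 1 c = 1"
proof -
  have "fermi_eq c \<longleftrightarrow> ((\<lambda>x. x * occupation 1 c x) has_integral 1) {0<..}"
    by (simp add: fermi_eq_def occupation_def has_integral_atLeast_iff_greaterThan)
  then show ?thesis
    using has_integral_mean_size[of 1 c] has_integral_unique[of _ 1 "{0<..}" "mean_size 1 c"]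
    by (auto simp: admissible_def)
qed

section \<open>The growth constant\<close>

definition growth :: "real \<Rightarrow> real \<Rightarrow> real" where
  "growth \<sigma> c = c + integral {0<..} (log_factor \<sigma> c)"

lemma integrable_log_factor: "admissible \<sigma> c \<Longrightarrow> log_factor \<sigma> c integrable_on {0<..}"
  using absolutely_integrable_log_factor by (simp add: absolutely_integrable_on_def)

text \<open>In the Fermi case \<open>c\<close> may be negative; the bound \<open>ln (1 + exp y) \<ge> ln 2 + y / 2\<close> on
  \<open>{0<..<2}\<close> makes the contribution of \<open>c\<close> cancel.\<close>

lemma growth_pos:
  assumes "admissible \<sigma> c"
  shows "0 < growth \<sigma> c"
proof (cases "\<sigma> = 1")
  case False
  then have "c > 0" using assms by (simp add: admissible_def)
  moreover have "0 \<le> integral {0<..} (log_factor \<sigma> c)"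
    using assms by (intro integral_nonneg integrable_log_factor log_factor_occupation_pos(3)) auto
  ultimately show ?thesis by (simp add: growth_def)
next
  case True
  have int: "log_factor \<sigma> c integrable_on {0<..<2}"
    using absolutely_integrable_log_factor[OF assms] by (rule integrable_Ioo_if_absolutely_integrable) simp
  \<comment> \<open>An antiderivative of the lower bound. The interval ends at 2 because c * 2^2 / 4
    = c; what remains after cancellation is 2 * ln 2 - 2/3.\<close>
  let ?F = "\<lambda>x. x * ln 2 - c * x\<^sup>2 / 4 - x ^ 3 / 12"
  have "((\<lambda>x. ln 2 + (- c * x - x\<^sup>2 / 2) / 2) has_integral ?F 2 - ?F 0) {0..2}"
    by (rule fundamental_theorem_of_calculus)
      (auto intro!: derivative_eq_intros simp: field_simps simp flip: has_real_derivative_iff_has_vector_derivative)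
  then have "?F 2 - ?F 0 \<le> integral {0<..<2} (log_factor \<sigma> c)"
    unfolding has_integral_Icc_iff_Ioo
  proof (rule has_integral_le[OF _ integrable_integral[OF int]])
    fix x :: real
    define y where "y = - c * x - x\<^sup>2 / 2"
    have "0 \<le> (exp (y / 2) - 1)\<^sup>2" by simp
    also have "\<dots> = exp y + 1 - 2 * exp (y / 2)"
      by (simp add: power2_eq_square algebra_simps flip: exp_add)
    finally have "ln (2 * exp (y / 2)) \<le> ln (1 + exp y)" by (intro ln_mono) auto
    then show "ln 2 + (- c * x - x\<^sup>2 / 2) / 2 \<le> log_factor \<sigma> c x"
      by (simp add: log_factor_def True y_def ln_mult)
  qed
  also have "\<dots> \<le> integral {0<..} (log_factor \<sigma> c)"
    using int assms by (intro integral_subset_le integrable_log_factor ballI log_factor_occupation_pos(3)) auto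
  finally have "2 * ln 2 - 2 / 3 \<le> growth \<sigma> c" by (simp add: growth_def)
  then show ?thesis using ln2_ge_two_thirds by linarith
qed

subsection \<open>Bounds for fixed size\<close>

lemma sums_parts:
  assumes "admissible \<sigma> c" "n > 0" "finite I" "\<And>k. k \<in> I \<Longrightarrow> k > 0"
  shows "(\<lambda>m. fps_nth (\<Prod>k\<in>I. factor \<sigma> n k) m * exp (- (c * (real m / sqrt (real n))))) sums
    exp (\<Sum>k\<in>I. log_factor \<sigma> c (real k * (1 / sqrt (real n))))"
proof -
  define u where "u = exp (- (c / sqrt (real n)))"
  have weight: "gauss_weight n k * u ^ k = exp (- c * (real k * (1 / sqrt (real n))) - (real k * (1 / sqrt (real n)))\<^sup>2 / 2)" for k
    using assms(2) by (simp add: gauss_weight_def u_def power_mult_distrib power_divide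
        flip: exp_of_nat_mult exp_add) (simp add: mult.commute)
  have "(\<lambda>m. fps_nth (\<Prod>k\<in>I. factor \<sigma> n k) m * u ^ m) sums
      (\<Prod>k\<in>I. exp (log_factor \<sigma> c (real k * (1 / sqrt (real n)))))"
  proof (rule sums_fps_prod)
    fix k assume "k \<in> I"
    then have k: "k > 0" by (rule assms(4))
    then have pos: "real k * (1 / sqrt (real n)) > 0" using assms(2) by simp
    have "\<sigma> = 1 \<or> \<sigma> = -1 \<and> gauss_weight n k * u ^ k < 1"
      unfolding weight using admissible_cases[OF assms(1) pos] by metis
    then show "(\<lambda>m. fps_nth (factor \<sigma> n k) m * u ^ m) sums exp (log_factor \<sigma> c (real k * (1 / sqrt (real n))))"
      unfolding log_factor_def weight[symmetric] using k by (intro sums_factor) (auto simp: u_def)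
    show "fps_nonneg (factor \<sigma> n k)" using k by (rule factor_nonneg)
  qed (use assms(3) in \<open>auto simp: u_def\<close>)
  moreover have "u ^ m = exp (- (c * (real m / sqrt (real n))))" for m
    by (simp add: u_def mult.commute flip: exp_of_nat_mult)
  ultimately show ?thesis using assms(3) by (simp add: exp_sum)
qed

lemma Z_stat_upper:
  assumes "admissible \<sigma> c" "n > 0"
  shows "Z_stat \<sigma> n \<le> exp (c * sqrt (real n) + (\<Sum>k\<in>{0<..n}. log_factor \<sigma> c (real k * (1 / sqrt (real n)))))"
proof -
  let ?P = "\<Prod>k\<in>{0<..n}. factor \<sigma> n k" and ?E = "exp (\<Sum>k\<in>{0<..n}. log_factor \<sigma> c (real k * (1 / sqrt (real n))))"
  have s: "(\<lambda>m. fps_nth ?P m * exp (- (c * (real m / sqrt (real n))))) sums ?E"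
    using assms by (intro sums_parts) auto
  have "fps_nonneg ?P" by (intro fps_nonneg_prod factor_nonneg) auto
  then have "(\<Sum>m\<in>{n}. fps_nth ?P m * exp (- (c * (real m / sqrt (real n))))) \<le> ?E"
    unfolding sums_unique[OF s] using s by (intro sum_le_suminf) (auto simp: sums_iff fps_nonneg_def)
  then have "fps_nth ?P n * exp (- (c * sqrt (real n))) \<le> ?E" by (simp add: real_div_sqrt)
  moreover have "{1..n} = {0<..n}" by auto
  ultimately show ?thesis by (simp add: Z_stat_def exp_add exp_minus field_simps)
qed

text \<open>The coefficients of the product over the parts \<open>k \<in> {K<..N}\<close> concentrate on sizes in the
  window \<open>{m. (1 - \<eta>) * n \<le> m \<le> n}\<close>: the mass on either side is controlled by moving the tilt
  from \<open>c\<close> to \<open>c - \<tau>\<close> and \<open>c + \<tau>\<close>. The parts \<open>k \<le> K\<close> then fill up the missing \<open>n - m\<close>.\<close>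

lemma Z_stat_lower:
  assumes adm: "admissible \<sigma> (c - \<tau>)" "0 < \<tau>" and n: "n > 0" and N: "N \<le> n" "K \<le> n" and \<beta>: "0 \<le> \<beta>"
    and small: "\<And>j. real j \<le> \<eta> * real n \<Longrightarrow> \<beta> \<le> fps_nth (\<Prod>k\<in>{1..K}. factor \<sigma> n k) j"
  defines "x \<equiv> (\<lambda>k. real k * (1 / sqrt (real n)))"
  defines "h \<equiv> 1 / sqrt (real n)"
  defines "R \<equiv> (\<lambda>c. h * (\<Sum>k\<in>{K<..N}. x k * occupation \<sigma> c (x k)))"
  shows "\<beta> * (exp (c * sqrt (real n) - \<bar>c\<bar> * \<eta> * sqrt (real n)) *
    (exp (\<Sum>k\<in>{K<..N}. log_factor \<sigma> c (x k)) *
      (1 - exp (\<tau> * sqrt (real n) * (R (c - \<tau>) - 1)) - exp (\<tau> * sqrt (real n) * (1 - \<eta> - R (c + \<tau>))))))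
    \<le> Z_stat \<sigma> n"
proof -
  define s where "s = sqrt (real n)"
  have s: "s > 0" using n by (simp add: s_def)
  have ns: "real n = s * s" by (simp add: s_def)
  define y where "y m = real m / s" for m
  let ?A = "\<Prod>k\<in>{K<..N}. factor \<sigma> n k" and ?B = "\<Prod>k\<in>{1..K}. factor \<sigma> n k"
  let ?f = "\<lambda>c m. fps_nth ?A m * exp (- (c * y m))"
  let ?S = "\<lambda>c. \<Sum>k\<in>{K<..N}. log_factor \<sigma> c (x k)"
  define W where "W = {m. m \<le> n \<and> real n - real m \<le> \<eta> * real n}"
  have finW: "finite W" by (rule finite_subset[of _ "{..n}"]) (auto simp: W_def)
  have nn: "fps_nonneg ?A" "fps_nonneg ?B"
    by (auto intro!: fps_nonneg_prod factor_nonneg)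
  have adm': "admissible \<sigma> c" "admissible \<sigma> (c + \<tau>)"
    using adm by (auto elim: admissible_mono)
  have f: "?f d sums exp (?S d)" if "admissible \<sigma> d" for d
    unfolding x_def y_def s_def using that n by (intro sums_parts) auto
  have xpos: "0 < x k" if "k \<in> {K<..N}" for k using that n by (auto simp: x_def)
  have sR: "s * R d = (\<Sum>k\<in>{K<..N}. x k * occupation \<sigma> d (x k))" for d
    using s by (simp add: R_def h_def s_def)
  \<comment> \<open>Off the window a shifted summand dominates: \<tau> * (m - n) / s \<ge> 0 for m >
    n, and \<tau> * ((1 - \<eta>) * n - m) / s \<ge> 0 for m below the window.\<close>
  have "exp (?S c) \<le> (\<Sum>m\<in>W. ?f c m) + exp (- \<tau> * s) * exp (?S (c - \<tau>)) +
      exp (\<tau> * s * (1 - \<eta>)) * exp (?S (c + \<tau>))"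
  proof (rule sums_le)
    show "?f c sums exp (?S c)" by (rule f[OF adm'(1)])
    show "(\<lambda>m. (if m \<in> W then ?f c m else 0) + exp (- \<tau> * s) * ?f (c - \<tau>) m +
        exp (\<tau> * s * (1 - \<eta>)) * ?f (c + \<tau>) m) sums ((\<Sum>m\<in>W. ?f c m) + exp (- \<tau> * s) * exp (?S (c - \<tau>)) +
        exp (\<tau> * s * (1 - \<eta>)) * exp (?S (c + \<tau>)))"
      by (intro sums_add sums_mult f adm adm' sums_If_finite_set finW)
    fix m
    have A: "0 \<le> fps_nth ?A m" using nn by (simp add: fps_nonneg_def)
    have pos: "0 \<le> exp (- \<tau> * s) * ?f (c - \<tau>) m" "0 \<le> exp (\<tau> * s * (1 - \<eta>)) * ?f (c + \<tau>) m" "0 \<le> ?f c m"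
      using A by auto
    consider "m \<in> W" | "m > n" | "real m < real n * (1 - \<eta>)"
      by (fastforce simp: W_def algebra_simps)
    then show "?f c m \<le> (if m \<in> W then ?f c m else 0) + exp (- \<tau> * s) * ?f (c - \<tau>) m +
        exp (\<tau> * s * (1 - \<eta>)) * ?f (c + \<tau>) m"
    proof cases
      case 2
      have "s * s \<le> real m" using 2 ns by linarith
      then have "s \<le> y m" using s by (simp add: y_def field_simps)
      then have "\<tau> * s \<le> \<tau> * y m" using adm by (intro mult_left_mono) auto
      then have "exp (- (c * y m)) \<le> exp (- \<tau> * s + - ((c - \<tau>) * y m))"
        by (simp add: algebra_simps)
      from mult_left_mono[OF this A] have "?f c m \<le> exp (- \<tau> * s) * ?f (c - \<tau>) m"
        by (simp only: exp_add mult_ac)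
      then show ?thesis using pos by simp
    next
      case 3
      then have "y m \<le> s * (1 - \<eta>)" using s by (simp add: y_def field_simps ns)
      then have "\<tau> * y m \<le> \<tau> * (s * (1 - \<eta>))" using adm by (intro mult_left_mono) auto
      then have "exp (- (c * y m)) \<le> exp (\<tau> * s * (1 - \<eta>) + - ((c + \<tau>) * y m))"
        by (simp add: algebra_simps)
      from mult_left_mono[OF this A] have "?f c m \<le> exp (\<tau> * s * (1 - \<eta>)) * ?f (c + \<tau>) m"
        by (simp only: exp_add mult_ac)
      then show ?thesis using pos by simp
    qed (use pos in simp)
  qed
  \<comment> \<open>The tangent at the shifted parameter, evaluated at c, bounds ?S (c - \<tau>) by
    ?S c + \<tau> * s * R (c - \<tau>). The tail is exponentially small once R (c - \<tau>) stays
    below 1; likewise for c + \<tau> with R above 1 - \<eta>.\<close>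
  moreover have "exp (- \<tau> * s) * exp (?S (c - \<tau>)) \<le> exp (?S c) * exp (\<tau> * s * (R (c - \<tau>) - 1))"
  proof -
    have "(\<Sum>k\<in>{K<..N}. log_factor \<sigma> (c - \<tau>) (x k) + (c - \<tau> - c) * (x k * occupation \<sigma> (c - \<tau>) (x k))) \<le> ?S c"
      by (intro sum_mono log_factor_above_tangent adm adm' xpos)
    then have "?S (c - \<tau>) - \<tau> * (s * R (c - \<tau>)) \<le> ?S c"
      unfolding sR by (simp add: sum.distrib sum_negf sum_subtractf flip: sum_distrib_left)
    then show ?thesis by (simp add: algebra_simps flip: exp_add)
  qed
  moreover have "exp (\<tau> * s * (1 - \<eta>)) * exp (?S (c + \<tau>)) \<le> exp (?S c) * exp (\<tau> * s * (1 - \<eta> - R (c + \<tau>)))"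
  proof -
    have "(\<Sum>k\<in>{K<..N}. log_factor \<sigma> (c + \<tau>) (x k) + (c + \<tau> - c) * (x k * occupation \<sigma> (c + \<tau>) (x k))) \<le> ?S c"
      by (intro sum_mono log_factor_above_tangent adm adm' xpos)
    then have "?S (c + \<tau>) + \<tau> * (s * R (c + \<tau>)) \<le> ?S c"
      unfolding sR by (simp add: sum.distrib flip: sum_distrib_left)
    then show ?thesis by (simp add: algebra_simps flip: exp_add)
  qed
  ultimately have window: "exp (?S c) * (1 - exp (\<tau> * s * (R (c - \<tau>) - 1)) - exp (\<tau> * s * (1 - \<eta> - R (c + \<tau>))))
      \<le> (\<Sum>m\<in>W. ?f c m)"
    by (simp add: algebra_simps)
  have "\<beta> * (exp (c * s - \<bar>c\<bar> * \<eta> * s) *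
      (exp (?S c) * (1 - exp (\<tau> * s * (R (c - \<tau>) - 1)) - exp (\<tau> * s * (1 - \<eta> - R (c + \<tau>))))))
      \<le> \<beta> * (exp (c * s - \<bar>c\<bar> * \<eta> * s) * (\<Sum>m\<in>W. ?f c m))"
    by (intro mult_left_mono window \<beta>) auto
  also have "\<dots> = (\<Sum>m\<in>W. \<beta> * (fps_nth ?A m * (exp (c * s - \<bar>c\<bar> * \<eta> * s) * exp (- (c * y m)))))"
    by (simp add: sum_distrib_left mult_ac)
  \<comment> \<open>Within the window 0 \<le> s - y m \<le> \<eta> * s. The absolute value of c is
    needed since c may be negative.\<close>
  also have "\<dots> \<le> (\<Sum>m\<in>W. \<beta> * (fps_nth ?A m * 1))"
  proof (intro sum_mono mult_left_mono \<beta>)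
    fix m assume m: "m \<in> W"
    show "0 \<le> fps_nth ?A m" using nn by (simp add: fps_nonneg_def)
    have "0 \<le> s - y m" "s - y m \<le> \<eta> * s"
    proof -
      have "real m \<le> s * s" "s * s - real m \<le> \<eta> * (s * s)"
        using m by (simp_all add: W_def flip: ns)
      then show "0 \<le> s - y m" "s - y m \<le> \<eta> * s"
        using s by (simp_all add: y_def field_simps)
    qed
    then have "c * (s - y m) \<le> \<bar>c\<bar> * (\<eta> * s)" by (intro mult_mono) auto
    then show "exp (c * s - \<bar>c\<bar> * \<eta> * s) * exp (- (c * y m)) \<le> 1"
      by (simp add: algebra_simps flip: exp_add)
  qed
  also have "\<dots> \<le> (\<Sum>m\<in>W. fps_nth ?A m * fps_nth ?B (n - m))"
  proof (rule sum_mono)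
    fix m assume "m \<in> W"
    then have "real (n - m) \<le> \<eta> * real n" by (simp add: W_def of_nat_diff)
    then show "\<beta> * (fps_nth ?A m * 1) \<le> fps_nth ?A m * fps_nth ?B (n - m)"
      using mult_left_mono[OF small[of "n - m"] fps_nonnegD[OF nn(1), of m]] by (simp add: mult.commute)
  qed
  also have "\<dots> \<le> (\<Sum>m=0..n. fps_nth ?A m * fps_nth ?B (n - m))"
    using nn by (intro sum_mono2) (auto simp: W_def fps_nonneg_def)
  also have "\<dots> = fps_nth (?A * ?B) n" by (simp add: fps_mult_nth)
  also have "?A * ?B = (\<Prod>k\<in>{K<..N} \<union> {1..K}. factor \<sigma> n k)"
    by (rule prod.union_disjoint[symmetric]) auto
  also have "fps_nth \<dots> n \<le> Z_stat \<sigma> n" using N by (intro Z_stat_ge_nth) auto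
  finally show ?thesis by (simp add: s_def)
qed

subsection \<open>Asymptotics\<close>

text \<open>Index ranges whose cells of width 1 / sqrt n stay inside S and eventually reach each of
  its points. One notion serves both the half-line of the upper bound and the truncated interval of
  the lower bound.\<close>

definition mesh :: "real set \<Rightarrow> (nat \<Rightarrow> nat) \<Rightarrow> (nat \<Rightarrow> nat) \<Rightarrow> bool" where
  "mesh S a b \<longleftrightarrow> S \<subseteq> {0<..} \<and> open S \<and>
    (\<forall>n. {real (a n) * (1 / sqrt (real n))<..<real (b n) * (1 / sqrt (real n))} \<subseteq> S) \<and>
    (\<forall>x\<in>S. \<forall>\<^sub>F n in sequentially. real (a n) * (1 / sqrt (real n)) < x \<and> x \<le> real (b n) * (1 / sqrt (real n)))"

lemma sqrt_eventually_ge: "\<forall>\<^sub>F n in sequentially. M \<le> sqrt (real n)"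
  using filterlim_compose[OF sqrt_at_top filterlim_real_sequentially] by (simp add: filterlim_at_top)

lemma inverse_sqrt_tendsto_0: "(\<lambda>n. 1 / sqrt (real n)) \<longlonglongrightarrow> 0"
  by (intro tendsto_divide_0[OF tendsto_const] filterlim_at_top_imp_at_infinity
      filterlim_compose[OF sqrt_at_top filterlim_real_sequentially])

lemma mesh_sum_tendsto:
  assumes mesh: "mesh S a b" and cont: "continuous_on S G" and D: "D integrable_on {0<..}"
    and bound: "\<And>x y. 0 < x \<Longrightarrow> x \<le> y \<Longrightarrow> \<bar>G y\<bar> \<le> D x"
  shows "(\<lambda>n. 1 / sqrt (real n) * (\<Sum>k\<in>{a n<..b n}. G (real k * (1 / sqrt (real n))))) \<longlonglongrightarrow> integral S G"
proof (rule riemann_sum_tendsto[where D = D])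
  have "0 \<le> D x" if "x \<in> {0<..}" for x using bound[of x x] that by simp
  then have "D absolutely_integrable_on {0<..}" by (intro nonnegative_absolutely_integrable_1 D)
  moreover have "S \<in> sets lebesgue" "S \<subseteq> {0<..}"
    using mesh by (auto simp: mesh_def intro!: borel_open sets_completionI_sets)
  ultimately have "D absolutely_integrable_on S" by (rule set_integrable_subset)
  then show "D integrable_on S" by (simp add: absolutely_integrable_on_def)
  show "S \<subseteq> {0<..}" "open S" using mesh by (simp_all add: mesh_def)
  show "{real (a n) * (1 / sqrt (real n))<..<real (b n) * (1 / sqrt (real n))} \<subseteq> S" for n
    using mesh unfolding mesh_def by blast
  show "\<forall>\<^sub>F n in sequentially. real (a n) * (1 / sqrt (real n)) < x \<and> x \<le> real (b n) * (1 / sqrt (real n))"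
    if "x \<in> S" for x using mesh that unfolding mesh_def by blast
qed (use cont bound inverse_sqrt_tendsto_0 in simp_all)

lemma mesh_sum_log_factor:
  assumes "mesh S a b" "admissible \<sigma> c"
  shows "(\<lambda>n. 1 / sqrt (real n) * (\<Sum>k\<in>{a n<..b n}. log_factor \<sigma> c (real k * (1 / sqrt (real n))))) \<longlonglongrightarrow>
    integral S (log_factor \<sigma> c)"
proof -
  obtain C \<beta> where C: "C > 0" "\<beta> > 0" "\<And>x. x > 0 \<Longrightarrow> log_factor \<sigma> c x \<le> C * (exp (- \<beta> * x) / sqrt x)"
    using log_factor_bound[OF assms(2)] by metis
  show ?thesis
  proof (rule mesh_sum_tendsto[OF assms(1)])
    show "(\<lambda>x. C * (exp (- \<beta> * x) / sqrt x)) integrable_on {0<..}"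
      by (intro integrable_on_mult_right integrable_inverse_sqrt_exp C)
    show "\<bar>log_factor \<sigma> c y\<bar> \<le> C * (exp (- \<beta> * x) / sqrt x)" if "0 < x" "x \<le> y" for x y
    proof -
      have "\<bar>log_factor \<sigma> c y\<bar> \<le> C * (exp (- \<beta> * y) / sqrt y)"
        using C(3)[of y] log_factor_occupation_pos(3)[OF assms(2), of y] that by simp
      also have "\<dots> \<le> C * (exp (- \<beta> * x) / sqrt x)"
        using that C by (intro mult_left_mono frac_le) auto
      finally show ?thesis .
    qed
  qed (use assms in \<open>auto simp: mesh_def intro: continuous_on_log_factor\<close>)
qed

lemma mesh_sum_x_occupation:
  assumes "mesh S a b" "admissible \<sigma> c"
  shows "(\<lambda>n. 1 / sqrt (real n) * (\<Sum>k\<in>{a n<..b n}. real k * (1 / sqrt (real n)) *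
    occupation \<sigma> c (real k * (1 / sqrt (real n))))) \<longlonglongrightarrow> integral S (\<lambda>x. x * occupation \<sigma> c x)"
proof -
  obtain C \<beta> where C: "C > 0" "\<beta> > 0" "\<And>x. x > 0 \<Longrightarrow> x * occupation \<sigma> c x \<le> C * exp (- \<beta> * x)"
    using x_occupation_bound[OF assms(2)] by metis
  show ?thesis
  proof (rule mesh_sum_tendsto[OF assms(1), where G = "\<lambda>x. x * occupation \<sigma> c x"])
    show "(\<lambda>x. C * exp (- \<beta> * x)) integrable_on {0<..}"
      using has_integral_exp_minus[OF C(2)] by (intro integrable_on_mult_right) blast
    show "\<bar>y * occupation \<sigma> c y\<bar> \<le> C * exp (- \<beta> * x)" if "0 < x" "x \<le> y" for x y
    proof -
      have "\<bar>y * occupation \<sigma> c y\<bar> \<le> C * exp (- \<beta> * y)"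
        using C(3)[of y] log_factor_occupation_pos(4)[OF assms(2), of y] that by simp
      also have "\<dots> \<le> C * exp (- \<beta> * x)"
        using that C by (intro mult_left_mono) auto
      finally show ?thesis .
    qed
  qed (use assms in \<open>auto simp: mesh_def intro!: continuous_on_occupation continuous_on_mult continuous_on_id\<close>)
qed

lemma mesh_all: "mesh {0<..} (\<lambda>_. 0) (\<lambda>n. n)"
  unfolding mesh_def
proof (intro conjI ballI allI)
  fix x :: real assume "x \<in> {0<..}"
  from sqrt_eventually_ge[of x] show "\<forall>\<^sub>F n in sequentially. real 0 * (1 / sqrt (real n)) < x \<and> x \<le> real n * (1 / sqrt (real n))"
    by eventually_elim (use \<open>x \<in> {0<..}\<close> in \<open>simp add: real_div_sqrt\<close>)
qed auto

text \<open>The left index is rounded up and the right one down, so the cells do not leave the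
  interval; the ends move by at most 1 / sqrt n.\<close>

lemma mesh_interval:
  assumes "0 < \<delta>"
  shows "mesh {\<delta><..<L} (\<lambda>n. nat \<lceil>\<delta> * sqrt (real n)\<rceil>) (\<lambda>n. nat \<lfloor>L * sqrt (real n)\<rfloor>)"
  unfolding mesh_def
proof (intro conjI ballI allI)
  fix n :: nat
  show "{real (nat \<lceil>\<delta> * sqrt (real n)\<rceil>) * (1 / sqrt (real n))<..<real (nat \<lfloor>L * sqrt (real n)\<rfloor>) * (1 / sqrt (real n))}
      \<subseteq> {\<delta><..<L}"
  proof (cases "n = 0")
    case False
    then have s: "sqrt (real n) > 0" by simp
    have "\<delta> \<le> real (nat \<lceil>\<delta> * sqrt (real n)\<rceil>) * (1 / sqrt (real n))"
      using s by (simp add: pos_le_divide_eq) linarith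
    moreover have "real (nat \<lfloor>L * sqrt (real n)\<rfloor>) * (1 / sqrt (real n)) \<le> L" if "L \<ge> 0"
    proof -
      have "0 \<le> L * sqrt (real n)" using that by simp
      then show ?thesis using s by (simp add: pos_divide_le_eq)
    qed
    moreover have "real (nat \<lfloor>L * sqrt (real n)\<rfloor>) * (1 / sqrt (real n)) = 0" if "L < 0"
    proof -
      have "L * sqrt (real n) < 0" using that s by (rule mult_neg_pos)
      then show ?thesis by simp
    qed
    ultimately show ?thesis using assms by (cases "L \<ge> 0") auto
  qed simp
next
  fix x assume x: "x \<in> {\<delta><..<L}"
  have "(\<lambda>n. \<delta> + 1 / sqrt (real n)) \<longlonglongrightarrow> \<delta> + 0" "(\<lambda>n. L - 1 / sqrt (real n)) \<longlonglongrightarrow> L - 0"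
    by (intro tendsto_intros inverse_sqrt_tendsto_0)+
  then have "\<forall>\<^sub>F n in sequentially. \<delta> + 1 / sqrt (real n) < x" "\<forall>\<^sub>F n in sequentially. x < L - 1 / sqrt (real n)"
    using x by (auto dest: order_tendstoD)
  with eventually_gt_at_top[of 0]
  show "\<forall>\<^sub>F n in sequentially. real (nat \<lceil>\<delta> * sqrt (real n)\<rceil>) * (1 / sqrt (real n)) < x \<and>
      x \<le> real (nat \<lfloor>L * sqrt (real n)\<rfloor>) * (1 / sqrt (real n))"
  proof eventually_elim
    case (elim n)
    then have s: "sqrt (real n) > 0" by simp
    have "0 \<le> \<delta> * sqrt (real n)" using assms s by simp
    then have "real (nat \<lceil>\<delta> * sqrt (real n)\<rceil>) \<le> \<delta> * sqrt (real n) + 1" by linarith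
    then have "real (nat \<lceil>\<delta> * sqrt (real n)\<rceil>) * (1 / sqrt (real n)) \<le> (\<delta> * sqrt (real n) + 1) * (1 / sqrt (real n))"
      using s by (intro mult_right_mono) auto
    also have "\<dots> = \<delta> + 1 / sqrt (real n)" using s by (simp add: add_divide_distrib)
    also have "\<dots> < x" by (rule elim)
    finally have 1: "real (nat \<lceil>\<delta> * sqrt (real n)\<rceil>) * (1 / sqrt (real n)) < x" .
    have "x \<le> L - 1 / sqrt (real n)" using elim by simp
    also have "\<dots> = (L * sqrt (real n) - 1) * (1 / sqrt (real n))" using s by (simp add: diff_divide_distrib)
    also have "\<dots> \<le> real (nat \<lfloor>L * sqrt (real n)\<rfloor>) * (1 / sqrt (real n))"
      using s by (intro mult_right_mono) (linarith, simp)
    finally show ?case using 1 by simp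
  qed
qed (use assms in auto)

section \<open>The lower bound and the limit of the logarithm\<close>

text \<open>The strict bounds on the truncated mean survive a small shift of c by continuity, and
  then the passage to Riemann sums, with a fixed margin. Both Markov tails therefore vanish as n
  grows.\<close>

lemma Z_stat_eventually_ge:
  assumes adm: "admissible \<sigma> c" and "0 < \<delta>"
    and J: "1 - \<eta> < integral {\<delta><..<L} (\<lambda>x. x * occupation \<sigma> c x)" "integral {\<delta><..<L} (\<lambda>x. x * occupation \<sigma> c x) < 1"
    and small: "\<forall>\<^sub>F n in sequentially. \<forall>j. real j \<le> \<eta> * real n \<longrightarrow>
      exp (- (\<kappa> * sqrt (real n))) \<le> fps_nth (\<Prod>k\<in>{1..nat \<lceil>\<delta> * sqrt (real n)\<rceil>}. factor \<sigma> n k) j"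
    and "\<rho> > 0"
  shows "\<forall>\<^sub>F n in sequentially. exp (sqrt (real n) * (c - \<bar>c\<bar> * \<eta> - \<kappa> + integral {\<delta><..<L} (log_factor \<sigma> c) - \<rho>)) \<le> Z_stat \<sigma> n"
proof -
  define K where "K n = nat \<lceil>\<delta> * sqrt (real n)\<rceil>" for n
  define N where "N n = nat \<lfloor>L * sqrt (real n)\<rfloor>" for n
  have mesh: "mesh {\<delta><..<L} K N" unfolding K_def N_def using \<open>0 < \<delta>\<close> by (rule mesh_interval)
  define J where "J d = integral {\<delta><..<L} (\<lambda>x. x * occupation \<sigma> d x)" for d
  \<comment> \<open>A smaller admissible parameter, so that c is interior to a range of continuity
    and a downward shift remains admissible.\<close>
  define c0 where "c0 = (if \<sigma> = 1 then c - 1 else c / 2)"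
  have c0: "admissible \<sigma> c0" "c0 < c" using adm by (auto simp: c0_def admissible_def)
  have "continuous_on {c0..} J"
    unfolding J_def
  proof (rule continuous_on_integral_x_occupation[OF c0(1)])
    fix d assume "c0 \<le> d"
    then have "(\<lambda>x. x * occupation \<sigma> d x) absolutely_integrable_on {0<..}"
      by (intro absolutely_integrable_x_occupation admissible_mono[OF c0(1)])
    then show "(\<lambda>x. x * occupation \<sigma> d x) integrable_on {\<delta><..<L}"
      by (rule integrable_Ioo_if_absolutely_integrable) (use \<open>0 < \<delta>\<close> in simp)
  qed (use \<open>0 < \<delta>\<close> in auto)
  then have "isCont J c" using c0 by (intro continuous_on_interior) auto
  moreover define \<epsilon> where "\<epsilon> = min (1 - J c) (J c - (1 - \<eta>))"
  moreover have "\<epsilon> > 0" using J by (simp add: \<epsilon>_def J_def)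
  ultimately obtain d where d: "d > 0" "\<And>x. \<bar>x - c\<bar> < d \<Longrightarrow> \<bar>J x - J c\<bar> < \<epsilon>"
    unfolding continuous_at_real_range by (metis real_norm_def)
  define \<tau> where "\<tau> = min d (c - c0) / 2"
  have \<tau>: "0 < \<tau>" "\<tau> < d" "c0 < c - \<tau>" using d c0 by (auto simp: \<tau>_def min_def field_simps)
  have adm': "admissible \<sigma> (c - \<tau>)" "admissible \<sigma> (c + \<tau>)"
    using \<tau> by (auto intro: admissible_mono[OF c0(1)])
  have J_less: "J (c - \<tau>) < 1" "1 - \<eta> < J (c + \<tau>)"
    using d(2)[of "c - \<tau>"] d(2)[of "c + \<tau>"] \<tau> unfolding \<epsilon>_def by auto
  define x where "x n k = real k * (1 / sqrt (real n))" for n k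
  define R where "R n d = 1 / sqrt (real n) * (\<Sum>k\<in>{K n<..N n}. x n k * occupation \<sigma> d (x n k))" for n d
  define \<Phi> where "\<Phi> n = 1 / sqrt (real n) * (\<Sum>k\<in>{K n<..N n}. log_factor \<sigma> c (x n k))" for n
  have R: "(\<lambda>n. R n d) \<longlonglongrightarrow> J d" if "admissible \<sigma> d" for d
    unfolding R_def x_def J_def by (rule mesh_sum_x_occupation[OF mesh that])
  have \<Phi>: "\<Phi> \<longlonglongrightarrow> integral {\<delta><..<L} (log_factor \<sigma> c)"
    unfolding \<Phi>_def x_def by (rule mesh_sum_log_factor[OF mesh adm])
  define \<gamma> where "\<gamma> = min (1 - J (c - \<tau>)) (J (c + \<tau>) - (1 - \<eta>)) / 2"
  have \<gamma>: "\<gamma> > 0" "J (c - \<tau>) < 1 - \<gamma>" "1 - \<eta> + \<gamma> < J (c + \<tau>)"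
    using J_less by (auto simp: \<gamma>_def min_def field_simps)
  \<comment> \<open>The thresholds: ln 4 / (\<tau> * \<gamma>) makes each tail at most 1/4, and ln 2
    / (\<rho> / 2) lets half of \<rho> pay for the remaining factor 1/2; the Riemann sum uses the
    other half. The bounds L and \<delta> + 1 ensure N n \<le> n and K n \<le> n.\<close>
  show ?thesis
    using order_tendstoD(2)[OF R[OF adm'(1)] \<gamma>(2)] order_tendstoD(1)[OF R[OF adm'(2)] \<gamma>(3)]
      order_tendstoD(1)[OF \<Phi>, of "integral {\<delta><..<L} (log_factor \<sigma> c) - \<rho> / 2", simplified, OF \<open>\<rho> > 0\<close>]
      sqrt_eventually_ge[of "ln 4 / (\<tau> * \<gamma>)"] sqrt_eventually_ge[of "ln 2 / (\<rho> / 2)"] sqrt_eventually_ge[of L] sqrt_eventually_ge[of "\<delta> + 1"]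
      eventually_gt_at_top[of 0] small
  proof eventually_elim
    case (elim n)
    define s where "s = sqrt (real n)"
    have s: "s > 0" "s \<ge> 1" "real n = s * s" 
    proof -
      show "s \<ge> 1" using elim(7) \<open>0 < \<delta>\<close> unfolding s_def by linarith
      then show "s > 0" by simp
      show "real n = s * s" by (simp add: s_def)
    qed
    have "L \<le> s" "\<delta> + 1 \<le> s" using elim(6,7) by (simp_all only: s_def)
    then have Ls: "L * s \<le> s * s" and \<delta>s: "(\<delta> + 1) * s \<le> s * s"
      using s(1) by (auto intro!: mult_right_mono)
    from Ls have N: "N n \<le> n" unfolding N_def s(3)[symmetric] s_def[symmetric] by linarith
    have "\<delta> * s + 1 \<le> real n" using \<delta>s s(2) unfolding s(3) by (simp add: distrib_right)
    then have K: "K n \<le> n" unfolding K_def s_def[symmetric] by linarith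
    have tail: "exp (\<tau> * s * t) \<le> 1 / 4" if "t \<le> - \<gamma>" for t
    proof -
      have "ln 4 \<le> s * (\<tau> * \<gamma>)" using elim(4) \<tau> \<gamma> by (simp add: s_def pos_divide_le_eq)
      also have "\<dots> = \<tau> * s * \<gamma>" by simp
      also have "\<dots> \<le> \<tau> * s * (- t)" using that \<tau> s(1) by (intro mult_left_mono) auto
      finally have "\<tau> * s * t \<le> ln (1 / 4)" by (simp add: ln_div)
      then have "exp (\<tau> * s * t) \<le> exp (ln (1 / 4))" by (simp only: exp_le_cancel_iff)
      then show ?thesis by simp
    qed
    have "ln 2 \<le> s * (\<rho> / 2)" using elim(5) \<open>\<rho> > 0\<close> by (simp add: s_def field_simps)
    then have "- (s * (\<rho> / 2)) \<le> ln (1 / 2)" by (simp add: ln_div)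
    then have half: "exp (- (s * (\<rho> / 2))) \<le> 1 / 2" by (metis exp_le_cancel_iff exp_ln half_gt_zero_iff zero_less_one)
    have sum: "(\<Sum>k\<in>{K n<..N n}. log_factor \<sigma> c (x n k)) = s * \<Phi> n"
      using s(1) by (simp add: \<Phi>_def s_def)
    have "s * (c - \<bar>c\<bar> * \<eta> - \<kappa> + integral {\<delta><..<L} (log_factor \<sigma> c) - \<rho>) \<le>
        - (\<kappa> * s) + ((c * s - \<bar>c\<bar> * \<eta> * s) + (s * \<Phi> n + - (s * (\<rho> / 2))))"
    proof -
      have "s * (integral {\<delta><..<L} (log_factor \<sigma> c) - \<rho> / 2) \<le> s * \<Phi> n"
        using elim(3) s(1) by (intro mult_left_mono) auto
      then show ?thesis by (simp add: algebra_simps)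
    qed
    then have "exp (s * (c - \<bar>c\<bar> * \<eta> - \<kappa> + integral {\<delta><..<L} (log_factor \<sigma> c) - \<rho>)) \<le>
        exp (- (\<kappa> * s)) * (exp (c * s - \<bar>c\<bar> * \<eta> * s) * (exp (s * \<Phi> n) * exp (- (s * (\<rho> / 2)))))"
      by (simp only: exp_le_cancel_iff flip: exp_add)
    also have "\<dots> \<le> exp (- (\<kappa> * s)) * (exp (c * s - \<bar>c\<bar> * \<eta> * s) * (exp (s * \<Phi> n) *
        (1 - exp (\<tau> * s * (R n (c - \<tau>) - 1)) - exp (\<tau> * s * (1 - \<eta> - R n (c + \<tau>))))))"
    proof (intro mult_left_mono)
      have "exp (\<tau> * s * (R n (c - \<tau>) - 1)) \<le> 1 / 4" "exp (\<tau> * s * (1 - \<eta> - R n (c + \<tau>))) \<le> 1 / 4"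
        using elim(1,2) by (intro tail; linarith)+
      then show "exp (- (s * (\<rho> / 2))) \<le> 1 - exp (\<tau> * s * (R n (c - \<tau>) - 1)) - exp (\<tau> * s * (1 - \<eta> - R n (c + \<tau>)))"
        using half by linarith
    qed auto
    also have "\<dots> \<le> Z_stat \<sigma> n"
      unfolding sum[symmetric] unfolding s_def R_def x_def
      by (rule Z_stat_lower[OF adm'(1) \<tau>(1) _ N K]) (use elim(8,9) in \<open>simp_all add: K_def\<close>)
    finally show ?case by (simp add: s_def)
  qed
qed

lemma mean_size_split:
  assumes "admissible \<sigma> c" "0 < \<delta>"
  shows "integral {0<..<\<delta>} (\<lambda>x. x * occupation \<sigma> c x) + integral {\<delta><..} (\<lambda>x. x * occupation \<sigma> c x) = mean_size \<sigma> c"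
proof -
  let ?g = "\<lambda>x. x * occupation \<sigma> c x"
  have "?g integrable_on {0<..<\<delta>}" "?g integrable_on {\<delta><..}"
    using absolutely_integrable_x_occupation[OF assms(1)]
    by (rule integrable_Ioo_if_absolutely_integrable; use assms(2) in simp)+
  then have "(?g has_integral integral {0<..<\<delta>} ?g) {0<..<\<delta>}"
    "(?g has_integral integral {\<delta><..} ?g) {\<delta>..}"
    by (simp_all add: integrable_integral has_integral_atLeast_iff_greaterThan)
  then have "(?g has_integral integral {0<..<\<delta>} ?g + integral {\<delta><..} ?g) ({0<..<\<delta>} \<union> {\<delta>..})"
    by (rule has_integral_Un) (auto intro: negligible_subset[of "{}"])
  moreover have "{0<..<\<delta>} \<union> {\<delta>..} = {0<..}" using assms(2) by auto
  ultimately show ?thesis unfolding mean_size_def by (simp add: integral_unique)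
qed

lemma integral_x_occupation_pos:
  assumes "admissible \<sigma> c" "0 \<le> a" "a < b" "{a<..<b} \<subseteq> S" "S \<subseteq> {0<..}" "(\<lambda>x. x * occupation \<sigma> c x) integrable_on S"
  shows "0 < integral S (\<lambda>x. x * occupation \<sigma> c x)"
proof (rule integral_pos[where a = "a + (b - a) / 3" and b = "a + 2 * (b - a) / 3"])
  have sub: "{a + (b - a) / 3..a + 2 * (b - a) / 3} \<subseteq> {a<..<b}" using assms(3) by (auto simp: field_simps)
  then show "{a + (b - a) / 3..a + 2 * (b - a) / 3} \<subseteq> S" using assms(4) by blast
  then show "continuous_on {a + (b - a) / 3..a + 2 * (b - a) / 3} (\<lambda>x. x * occupation \<sigma> c x)"
    using assms(1,5) by (intro continuous_on_mult continuous_on_id continuous_on_occupation) auto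
  show "0 \<le> x * occupation \<sigma> c x" if "x \<in> S" for x
    using that assms(5) log_factor_occupation_pos(4)[OF assms(1), of x] by (auto simp: less_imp_le)
  show "0 < x * occupation \<sigma> c x" if "x \<in> {a + (b - a) / 3<..<a + 2 * (b - a) / 3}" for x
  proof -
    have "0 \<le> (b - a) / 3" using assms(3) by simp
    then have "x > 0" using that assms(2) by (simp only: greaterThanLessThan_iff) linarith
    then show ?thesis using log_factor_occupation_pos(4)[OF assms(1)] by simp
  qed
  show "a + (b - a) / 3 < a + 2 * (b - a) / 3" using assms(3) by simp
qed (fact assms(6))

text \<open>The assumption \<open>small\<close> isolates what depends on the statistics. There
  \<eta> must strictly exceed the mean lost below \<delta>, leaving room for the cut at L, and yet
  exceed it by at most \<delta>, so that it vanishes with \<delta>.\<close>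

lemma ln_Z_stat_div_sqrt_tendsto:
  assumes adm: "admissible \<sigma> c" and mean: "mean_size \<sigma> c = 1"
    and small: "\<And>\<delta>. 0 < \<delta> \<Longrightarrow> \<delta> \<le> 1 / 2 \<Longrightarrow> \<exists>\<eta>. integral {0<..<\<delta>} (\<lambda>x. x * occupation \<sigma> c x) < \<eta> \<and>
      \<eta> \<le> integral {0<..<\<delta>} (\<lambda>x. x * occupation \<sigma> c x) + \<delta> \<and>
      (\<forall>\<^sub>F n in sequentially. \<forall>j. real j \<le> \<eta> * real n \<longrightarrow>
        exp (- (\<delta> * sqrt (real n))) \<le> fps_nth (\<Prod>k\<in>{1..nat \<lceil>\<delta> * sqrt (real n)\<rceil>}. factor \<sigma> n k) j)"
  shows "(\<lambda>n. ln (Z_stat \<sigma> n) / sqrt (real n)) \<longlonglongrightarrow> growth \<sigma> c"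
proof -
  let ?g = "\<lambda>x. x * occupation \<sigma> c x"
  note abs_g = absolutely_integrable_x_occupation[OF adm] and abs_f = absolutely_integrable_log_factor[OF adm]
  define \<delta> where "\<delta> m = 1 / real (m + 2)" for m
  have \<delta>: "0 < \<delta> m" "\<delta> m \<le> 1 / 2" for m by (auto simp: \<delta>_def field_simps)
  have \<delta>0: "\<delta> \<longlonglongrightarrow> 0"
    unfolding \<delta>_def by (rule LIMSEQ_ignore_initial_segment[OF lim_1_over_n])
  define E where "E d = integral {0<..<d} ?g" for d
  have split: "E (\<delta> m) + integral {\<delta> m<..} ?g = 1" for m
    unfolding E_def using mean_size_split[OF adm \<delta>(1)] mean by simp
  have "\<forall>m. \<exists>\<eta>. E (\<delta> m) < \<eta> \<and> \<eta> \<le> E (\<delta> m) + \<delta> m \<and> (\<forall>\<^sub>F n in sequentially. \<forall>j. real j \<le> \<eta> * real n \<longrightarrow>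
        exp (- (\<delta> m * sqrt (real n))) \<le> fps_nth (\<Prod>k\<in>{1..nat \<lceil>\<delta> m * sqrt (real n)\<rceil>}. factor \<sigma> n k) j)"
    unfolding E_def using small[OF \<delta>] by blast
  from choice[OF this] obtain \<eta> where \<eta>: "\<And>m. E (\<delta> m) < \<eta> m" "\<And>m. \<eta> m \<le> E (\<delta> m) + \<delta> m"
    and small': "\<And>m. \<forall>\<^sub>F n in sequentially. \<forall>j. real j \<le> \<eta> m * real n \<longrightarrow>
        exp (- (\<delta> m * sqrt (real n))) \<le> fps_nth (\<Prod>k\<in>{1..nat \<lceil>\<delta> m * sqrt (real n)\<rceil>}. factor \<sigma> n k) j"
    by blast
  \<comment> \<open>The cut may be taken so far out that the truncated mean still exceeds 1 - \<eta>
    m; real m \<le> L forces the cuts to infinity.\<close>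
  have "\<forall>m. \<exists>L. real m \<le> L \<and> 1 - \<eta> m < integral {\<delta> m<..<L} ?g"
  proof
    fix m
    have "(\<lambda>i. integral {\<delta> m<..<real i} ?g) \<longlonglongrightarrow> integral {\<delta> m<..} ?g"
    proof (rule integral_truncation_tendsto)
      show "?g absolutely_integrable_on {\<delta> m<..}"
        by (rule set_integrable_subset[OF abs_g]) (use \<delta>(1)[of m] in auto)
    qed (auto intro: filterlim_real_sequentially)
    moreover have "1 - \<eta> m < integral {\<delta> m<..} ?g" using split[of m] \<eta>(1)[of m] by linarith
    ultimately have "\<forall>\<^sub>F i in sequentially. 1 - \<eta> m < integral {\<delta> m<..<real i} ?g"
      by (rule order_tendstoD(1))
    with eventually_ge_at_top[of m] have "\<forall>\<^sub>F i in sequentially. m \<le> i \<and> 1 - \<eta> m < integral {\<delta> m<..<real i} ?g"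
      by eventually_elim simp
    then obtain i where "m \<le> i" "1 - \<eta> m < integral {\<delta> m<..<real i} ?g"
      by (auto simp: eventually_sequentially)
    then show "\<exists>L. real m \<le> L \<and> 1 - \<eta> m < integral {\<delta> m<..<L} ?g"
      by (intro exI[of _ "real i"]) simp
  qed
  from choice[OF this] obtain L
    where L: "\<And>m. real m \<le> L m" "\<And>m. 1 - \<eta> m < integral {\<delta> m<..<L m} ?g"
    by blast
  have L_top: "filterlim L at_top sequentially"
    by (rule filterlim_at_top_mono[OF filterlim_real_sequentially]) (use L in simp)
  have lim: "(\<lambda>m. integral {\<delta> m<..<L m} (log_factor \<sigma> c)) \<longlonglongrightarrow> integral {0<..} (log_factor \<sigma> c)"
    "(\<lambda>m. integral {\<delta> m<..<L m} ?g) \<longlonglongrightarrow> 1"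
    using integral_truncation_tendsto[OF abs_f \<delta>0 _ L_top] integral_truncation_tendsto[OF abs_g \<delta>0 _ L_top]
      \<delta>(1) mean by (auto simp: mean_size_def less_imp_le)
  have int: "?g integrable_on {\<delta> m<..<L m}" "?g integrable_on {\<delta> m<..}" "?g integrable_on {0<..<\<delta> m}" for m
    by (rule integrable_Ioo_if_absolutely_integrable[OF abs_g]; use \<delta>(1)[of m] in simp)+
  have le: "integral {\<delta> m<..<L m} ?g \<le> integral {\<delta> m<..} ?g" for m
  proof (intro integral_subset_le int ballI)
    fix x assume "x \<in> {\<delta> m<..}"
    then have "x > 0" using \<delta>(1)[of m] by simp
    then show "0 \<le> ?g x" using log_factor_occupation_pos(4)[OF adm, of x] by simp
  qed auto
  have E_pos: "0 < E (\<delta> m)" for m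
    unfolding E_def by (rule integral_x_occupation_pos[OF adm _ \<delta>(1)[of m]]) (auto intro: int)
  have E0: "(\<lambda>m. E (\<delta> m)) \<longlonglongrightarrow> 0"
  proof (rule tendsto_sandwich[where f = "\<lambda>_. 0" and h = "\<lambda>m. 1 - integral {\<delta> m<..<L m} ?g"])
    show "\<forall>\<^sub>F m in sequentially. 0 \<le> E (\<delta> m)" using E_pos by (simp add: less_imp_le)
    show "\<forall>\<^sub>F m in sequentially. E (\<delta> m) \<le> 1 - integral {\<delta> m<..<L m} ?g"
    proof (rule always_eventually, rule allI)
      show "E (\<delta> m) \<le> 1 - integral {\<delta> m<..<L m} ?g" for m using split[of m] le[of m] by linarith
    qed
    show "(\<lambda>m. 1 - integral {\<delta> m<..<L m} ?g) \<longlonglongrightarrow> 0"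
      using tendsto_diff[OF tendsto_const lim(2), of 1] by simp
  qed simp
  \<comment> \<open>The rate of the lower bound up to its slack \<rho> / 2, with \<eta> m replaced
    by its upper bound, so that only quantities with known limits occur.\<close>
  define v where "v m = c - \<bar>c\<bar> * (E (\<delta> m) + \<delta> m) - \<delta> m + integral {\<delta> m<..<L m} (log_factor \<sigma> c)" for m
  have "v \<longlonglongrightarrow> c - \<bar>c\<bar> * (0 + 0) - 0 + integral {0<..} (log_factor \<sigma> c)"
    unfolding v_def by (intro tendsto_intros E0 \<delta>0 lim)
  then have v: "v \<longlonglongrightarrow> growth \<sigma> c" by (simp add: growth_def)
  have lower: "\<forall>\<^sub>F n in sequentially. exp (sqrt (real n) * (growth \<sigma> c - \<rho>)) \<le> Z_stat \<sigma> n" if "\<rho> > 0" for \<rho>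
  proof -
    have "\<forall>\<^sub>F m in sequentially. growth \<sigma> c - \<rho> / 2 < v m"
      using that by (intro order_tendstoD(1)[OF v]) simp
    then obtain m where m: "growth \<sigma> c - \<rho> / 2 < v m" by (auto simp: eventually_sequentially)
    \<comment> \<open>Strict because the removed interval below \<delta> m has positive
      mass.\<close>
    have J: "integral {\<delta> m<..<L m} ?g < 1" using le[of m] split[of m] E_pos[of m] by linarith
    have "\<rho> / 2 > 0" using that by simp
    from Z_stat_eventually_ge[OF adm \<delta>(1) L(2) J small' this] show ?thesis
    proof eventually_elim
      case (elim n)
      have "\<bar>c\<bar> * \<eta> m \<le> \<bar>c\<bar> * (E (\<delta> m) + \<delta> m)" by (intro mult_left_mono \<eta>) simp
      then have "growth \<sigma> c - \<rho> \<le> c - \<bar>c\<bar> * \<eta> m - \<delta> m + integral {\<delta> m<..<L m} (log_factor \<sigma> c) - \<rho> / 2"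
        using m by (simp add: v_def)
      then have "sqrt (real n) * (growth \<sigma> c - \<rho>) \<le>
          sqrt (real n) * (c - \<bar>c\<bar> * \<eta> m - \<delta> m + integral {\<delta> m<..<L m} (log_factor \<sigma> c) - \<rho> / 2)"
        by (intro mult_left_mono) auto
      then show ?case using elim by (meson exp_le_cancel_iff order_trans)
    qed
  qed
  have up: "(\<lambda>n. c + 1 / sqrt (real n) * (\<Sum>k\<in>{0<..n}. log_factor \<sigma> c (real k * (1 / sqrt (real n))))) \<longlonglongrightarrow> growth \<sigma> c"
    unfolding growth_def by (intro tendsto_add tendsto_const mesh_sum_log_factor[OF mesh_all adm])
  show ?thesis
  proof (rule order_tendstoI)
    fix a assume a: "a < growth \<sigma> c"
    then have "(growth \<sigma> c - a) / 2 > 0" by simp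
    from lower[OF this] eventually_gt_at_top[of 0]
    show "\<forall>\<^sub>F n in sequentially. a < ln (Z_stat \<sigma> n) / sqrt (real n)"
    proof eventually_elim
      case (elim n)
      then have s: "sqrt (real n) > 0" by simp
      have "sqrt (real n) * a < sqrt (real n) * (growth \<sigma> c - (growth \<sigma> c - a) / 2)"
        using s
      proof (rule mult_strict_left_mono[rotated])
        show "a < growth \<sigma> c - (growth \<sigma> c - a) / 2" using a by (simp add: field_simps)
      qed
      also have "\<dots> \<le> ln (Z_stat \<sigma> n)"
        using elim(1) by (subst ln_ge_iff) (auto intro: less_le_trans[OF exp_gt_zero])
      finally show ?case using s by (simp add: pos_less_divide_eq mult.commute)
    qed
  next
    fix a assume "growth \<sigma> c < a"
    \<comment> \<open>The lower bound is used here only for positivity of the coefficient, which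
      monotonicity of ln needs.\<close>
    from order_tendstoD(2)[OF up this] lower[of 1, OF zero_less_one] eventually_gt_at_top[of 0]
    show "\<forall>\<^sub>F n in sequentially. ln (Z_stat \<sigma> n) / sqrt (real n) < a"
    proof eventually_elim
      case (elim n)
      then have s: "sqrt (real n) > 0" by simp
      let ?S = "\<Sum>k\<in>{0<..n}. log_factor \<sigma> c (real k * (1 / sqrt (real n)))"
      have "0 < Z_stat \<sigma> n" using elim(2) by (rule less_le_trans[OF exp_gt_zero])
      then have "ln (Z_stat \<sigma> n) \<le> ln (exp (c * sqrt (real n) + ?S))"
        using Z_stat_upper[OF adm elim(3)] by (intro ln_mono) auto
      then have "ln (Z_stat \<sigma> n) / sqrt (real n) \<le> (c * sqrt (real n) + ?S) / sqrt (real n)"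
        using s by (intro divide_right_mono) auto
      also have "\<dots> = c + 1 / sqrt (real n) * ?S" using s by (simp add: add_divide_distrib)
      also note elim(1)
      finally show ?case .
    qed
  qed
qed

text \<open>The choice is \<eta> = \<delta>^2 / 2: the parts up to K \<ge> \<delta> * sqrt n sum to
  at least \<delta>^2 * n / 2. It strictly exceeds the lost mean because the occupation is below 1,
  so the integrand is below x.\<close>

lemma ln_Z_stat_div_sqrt_tendsto_fermi:
  assumes "mean_size 1 c = 1"
  shows "(\<lambda>n. ln (Z_stat 1 n) / sqrt (real n)) \<longlonglongrightarrow> growth 1 c"
proof (rule ln_Z_stat_div_sqrt_tendsto)
  show adm: "admissible 1 c" by (simp add: admissible_def)
  fix \<delta> :: real assume \<delta>: "0 < \<delta>" "\<delta> \<le> 1 / 2"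
  let ?g = "\<lambda>x. x * occupation 1 c x"
  have int: "?g integrable_on {0<..<\<delta>}"
    using absolutely_integrable_x_occupation[OF adm] by (rule integrable_Ioo_if_absolutely_integrable) simp
  have "((\<lambda>x. x) has_integral (\<delta>\<^sup>2 / 2 - 0\<^sup>2 / 2)) {0..\<delta>}"
    using \<delta> by (intro ident_has_integral[THEN has_integral_eq_rhs]) (auto simp: diff_divide_distrib)
  then have "((\<lambda>x. x - ?g x) has_integral \<delta>\<^sup>2 / 2 - integral {0<..<\<delta>} ?g) {0<..<\<delta>}"
    using int by (intro has_integral_diff integrable_integral) (simp_all add: has_integral_Icc_iff_Ioo)
  moreover have pos: "0 < x - ?g x" if "x > 0" for x
  proof -
    have "occupation 1 c x < 1" by (simp add: occupation_def divide_less_eq add_pos_pos)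
    then show ?thesis using that by simp
  qed
  have "0 < integral {0<..<\<delta>} (\<lambda>x. x - ?g x)"
  proof (rule integral_pos[where a = "\<delta> / 3" and b = "\<delta> / 2"])
    show "(\<lambda>x. x - ?g x) integrable_on {0<..<\<delta>}" using calculation by blast
    show "continuous_on {\<delta> / 3..\<delta> / 2} (\<lambda>x. x - ?g x)"
      using \<delta> by (intro continuous_intros continuous_on_occupation adm) auto
    show "0 \<le> x - ?g x" if "x \<in> {0<..<\<delta>}" for x
      using pos[of x] that by (simp only: greaterThanLessThan_iff less_imp_le)
    show "0 < x - ?g x" if "x \<in> {\<delta> / 3<..<\<delta> / 2}" for x
      using that \<delta> by (intro pos) auto
  qed (use \<delta> in auto)
  ultimately have less: "integral {0<..<\<delta>} ?g < \<delta>\<^sup>2 / 2" by (simp add: integral_unique)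
  have nonneg: "0 \<le> integral {0<..<\<delta>} ?g"
    using int log_factor_occupation_pos(4)[OF adm] by (intro integral_nonneg) (auto simp: less_imp_le)
  have "\<delta>\<^sup>2 / 2 \<le> \<delta>" using \<delta> by (simp add: power2_eq_square)
  moreover have "\<forall>\<^sub>F n in sequentially. \<forall>j. real j \<le> \<delta>\<^sup>2 / 2 * real n \<longrightarrow>
      exp (- (\<delta> * sqrt (real n))) \<le> fps_nth (\<Prod>k\<in>{1..nat \<lceil>\<delta> * sqrt (real n)\<rceil>}. factor 1 n k) j"
    using sqrt_eventually_ge[of "1 / \<delta>"] eventually_gt_at_top[of 0]
  proof eventually_elim
    case (elim n)
    define s where "s = sqrt (real n)"
    define K where "K = nat \<lceil>\<delta> * s\<rceil>"
    have s: "s > 0" "real n = s * s" "1 \<le> \<delta> * s" using elim \<delta> by (simp_all add: s_def field_simps)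
    have K: "\<delta> * s \<le> real K" "real K \<le> 2 * (\<delta> * s)" using s unfolding K_def by linarith+
    show ?case
    proof (intro allI impI)
      fix j assume j: "real j \<le> \<delta>\<^sup>2 / 2 * real n"
      have "real (2 * j) \<le> (\<delta> * s) * (\<delta> * s)" using j by (simp add: s(2) power2_eq_square mult_ac)
      also have "\<dots> \<le> real K * (real K + 1)" using K s by (intro mult_mono) auto
      also have "\<dots> = real (K * (K + 1))" by (simp add: algebra_simps)
      finally have "2 * j \<le> K * (K + 1)" by (simp only: of_nat_le_iff)
      then have "exp (- (real K ^ 3 / (2 * real n))) \<le> fps_nth (\<Prod>k\<in>{1..K}. factor 1 n k) j"
        using elim by (intro small_parts_fermi) auto
      \<comment> \<open>From K \<le> 2 * \<delta> * s the quotient is at most 4 * \<delta>^3 * s;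
        this is where \<delta> \<le> 1/2 comes from.\<close>
      moreover have "real K ^ 3 / (2 * real n) \<le> \<delta> * s"
      proof -
        have "real K ^ 3 \<le> (2 * (\<delta> * s)) ^ 3" using K by (intro power_mono) auto
        also have "\<dots> = \<delta> * \<delta> * (8 * (\<delta> * s * (s * s)))" by (simp add: power3_eq_cube)
        also have "\<dots> \<le> 1 / 2 * (1 / 2) * (8 * (\<delta> * s * (s * s)))"
          using \<delta> s by (intro mult_right_mono mult_mono) auto
        finally show ?thesis using s by (simp add: divide_le_eq mult_ac)
      qed
      then have "exp (- (\<delta> * s)) \<le> exp (- (real K ^ 3 / (2 * real n)))" by simp
      ultimately show "exp (- (\<delta> * sqrt (real n))) \<le> fps_nth (\<Prod>k\<in>{1..nat \<lceil>\<delta> * sqrt (real n)\<rceil>}. factor 1 n k) j"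
        unfolding K_def s_def by linarith
    qed
  qed
  ultimately show "\<exists>\<eta>. integral {0<..<\<delta>} ?g < \<eta> \<and> \<eta> \<le> integral {0<..<\<delta>} ?g + \<delta> \<and>
      (\<forall>\<^sub>F n in sequentially. \<forall>j. real j \<le> \<eta> * real n \<longrightarrow>
        exp (- (\<delta> * sqrt (real n))) \<le> fps_nth (\<Prod>k\<in>{1..nat \<lceil>\<delta> * sqrt (real n)\<rceil>}. factor 1 n k) j)"
    using less nonneg by (intro exI[of _ "\<delta>\<^sup>2 / 2"]) auto
qed (fact assms)

lemma ln_Z_stat_div_sqrt_tendsto_bose:
  assumes adm: "admissible (-1) c" and mean: "mean_size (-1) c = 1"
  shows "(\<lambda>n. ln (Z_stat (-1) n) / sqrt (real n)) \<longlonglongrightarrow> growth (-1) c"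
proof (rule ln_Z_stat_div_sqrt_tendsto[OF adm mean])
  fix \<delta> :: real assume \<delta>: "0 < \<delta>" "\<delta> \<le> 1 / 2"
  let ?g = "\<lambda>x. x * occupation (-1) c x"
  have "?g integrable_on {\<delta><..}"
    using absolutely_integrable_x_occupation[OF adm] by (rule integrable_Ioo_if_absolutely_integrable) (use \<delta> in simp)
  then have "0 < integral {\<delta><..} ?g"
    using \<delta> by (intro integral_x_occupation_pos[OF adm, of \<delta> "\<delta> + 1"]) auto
  then have less: "integral {0<..<\<delta>} ?g < 1" using mean_size_split[OF adm \<delta>(1)] mean by linarith
  \<comment> \<open>The cap 1 keeps j \<le> n, as filling with ones requires; the lost mean stays
    strictly below it because mass remains beyond \<delta>.\<close>
  define \<eta> where "\<eta> = min 1 (integral {0<..<\<delta>} ?g + \<delta>)"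
  have "\<forall>\<^sub>F n in sequentially. \<forall>j. real j \<le> \<eta> * real n \<longrightarrow>
      exp (- (\<delta> * sqrt (real n))) \<le> fps_nth (\<Prod>k\<in>{1..nat \<lceil>\<delta> * sqrt (real n)\<rceil>}. factor (-1) n k) j"
    using sqrt_eventually_ge[of "1 / \<delta>"] eventually_gt_at_top[of 0]
  proof eventually_elim
    case (elim n)
    have s: "1 \<le> \<delta> * sqrt (real n)" using elim \<delta> by (simp add: field_simps)
    show ?case
    proof (intro allI impI)
      fix j assume j: "real j \<le> \<eta> * real n"
      have "\<eta> * real n \<le> 1 * real n" by (intro mult_right_mono) (auto simp: \<eta>_def)
      then have "j \<le> n" using j by simp
      have "1 \<le> nat \<lceil>\<delta> * sqrt (real n)\<rceil>" using s by linarith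
      then have "exp (- 1 / 2) \<le> fps_nth (\<Prod>k\<in>{1..nat \<lceil>\<delta> * sqrt (real n)\<rceil>}. factor (-1) n k) j"
        using \<open>j \<le> n\<close> elim by (intro small_parts_bose) auto
      moreover have "exp (- (\<delta> * sqrt (real n))) \<le> exp (- 1 / 2)"
        unfolding exp_le_cancel_iff using s by linarith
      ultimately show "exp (- (\<delta> * sqrt (real n))) \<le> fps_nth (\<Prod>k\<in>{1..nat \<lceil>\<delta> * sqrt (real n)\<rceil>}. factor (-1) n k) j"
        by linarith
    qed
  qed
  moreover have "integral {0<..<\<delta>} ?g < \<eta>" "\<eta> \<le> integral {0<..<\<delta>} ?g + \<delta>"
    using less \<delta> by (auto simp: \<eta>_def)
  ultimately show "\<exists>\<eta>. integral {0<..<\<delta>} ?g < \<eta> \<and> \<eta> \<le> integral {0<..<\<delta>} ?g + \<delta> \<and>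
      (\<forall>\<^sub>F n in sequentially. \<forall>j. real j \<le> \<eta> * real n \<longrightarrow>
        exp (- (\<delta> * sqrt (real n))) \<le> fps_nth (\<Prod>k\<in>{1..nat \<lceil>\<delta> * sqrt (real n)\<rceil>}. factor (-1) n k) j)"
    by blast
qed

text \<open>A zero limit would not determine an asymptotic equivalence; positivity of the growth
  constant rules it out.\<close>

lemma asymp_equiv_if_quotient_tendsto:
  assumes "(\<lambda>n. f n / sqrt (real n)) \<longlonglongrightarrow> g" "g \<noteq> 0"
  shows "f \<sim>[sequentially] (\<lambda>n. g * sqrt (real n))"
proof (rule asymp_equivI')
  have "(\<lambda>n. f n / sqrt (real n) / g) \<longlonglongrightarrow> g / g"
    using assms by (intro tendsto_divide tendsto_const)
  then show "(\<lambda>n. f n / (g * sqrt (real n))) \<longlonglongrightarrow> 1"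
    using assms(2) by (simp add: mult.commute)
qed

lemma log_factor_atLeast:
  assumes "admissible \<sigma> c"
  shows "log_factor \<sigma> c integrable_on {0..}" "c + integral {0..} (log_factor \<sigma> c) = growth \<sigma> c"
proof -
  have "(log_factor \<sigma> c has_integral integral {0<..} (log_factor \<sigma> c)) {0..}"
    using integrable_integral[OF integrable_log_factor[OF assms]] by (simp add: has_integral_atLeast_iff_greaterThan)
  then show "log_factor \<sigma> c integrable_on {0..}" "c + integral {0..} (log_factor \<sigma> c) = growth \<sigma> c"
    by (auto simp: growth_def integral_unique)
qed

theorem theorem12:
  shows "((\<exists>!c. bose_eq c) \<and>
          (\<forall>c. bose_eq c \<longrightarrow>
             (\<lambda>x. - ln (1 - exp (- c * x - x\<^sup>2 / 2))) integrable_on {0..} \<and>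
             (\<lambda>n. ln (Z n)) \<sim>[sequentially]
               (\<lambda>n. (c + integral {0..} (\<lambda>x. - ln (1 - exp (- c * x - x\<^sup>2 / 2)))) * sqrt (real n)))) \<and>
         ((\<exists>!c. fermi_eq c) \<and>
          (\<forall>c. fermi_eq c \<longrightarrow>
             (\<lambda>x. ln (1 + exp (- c * x - x\<^sup>2 / 2))) integrable_on {0..} \<and>
             (\<lambda>n. ln (Z_dist n)) \<sim>[sequentially]
               (\<lambda>n. (c + integral {0..} (\<lambda>x. ln (1 + exp (- c * x - x\<^sup>2 / 2)))) * sqrt (real n))))"
proof (intro conjI allI impI)
  have bose: "(\<lambda>x. - ln (1 - exp (- c * x - x\<^sup>2 / 2))) = log_factor (-1) c" for c
    by (simp add: log_factor_def fun_eq_iff)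
  have fermi: "(\<lambda>x. ln (1 + exp (- c * x - x\<^sup>2 / 2))) = log_factor 1 c" for c
    by (simp add: log_factor_def fun_eq_iff)
  show "\<exists>!c. bose_eq c" unfolding bose_eq_iff by (rule ex1_mean_size_eq_1) simp
  show "\<exists>!c. fermi_eq c" unfolding fermi_eq_iff by (rule ex1_mean_size_eq_1) simp
  {
    fix c assume "bose_eq c"
    then have c: "admissible (-1) c" "mean_size (-1) c = 1" by (simp_all add: bose_eq_iff)
    show "(\<lambda>x. - ln (1 - exp (- c * x - x\<^sup>2 / 2))) integrable_on {0..}"
      unfolding bose by (rule log_factor_atLeast(1)[OF c(1)])
    show "(\<lambda>n. ln (Z n)) \<sim>[sequentially]
        (\<lambda>n. (c + integral {0..} (\<lambda>x. - ln (1 - exp (- c * x - x\<^sup>2 / 2)))) * sqrt (real n))"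
      unfolding bose log_factor_atLeast(2)[OF c(1)] Z_eq
      using ln_Z_stat_div_sqrt_tendsto_bose[OF c] growth_pos[OF c(1)] by (intro asymp_equiv_if_quotient_tendsto) auto
  }
  {
    fix c assume "fermi_eq c"
    then have c: "admissible 1 c" "mean_size 1 c = 1" by (simp_all add: fermi_eq_iff)
    show "(\<lambda>x. ln (1 + exp (- c * x - x\<^sup>2 / 2))) integrable_on {0..}"
      unfolding fermi by (rule log_factor_atLeast(1)[OF c(1)])
    show "(\<lambda>n. ln (Z_dist n)) \<sim>[sequentially]
        (\<lambda>n. (c + integral {0..} (\<lambda>x. ln (1 + exp (- c * x - x\<^sup>2 / 2)))) * sqrt (real n))"
      unfolding fermi log_factor_atLeast(2)[OF c(1)] Z_dist_eq
      using ln_Z_stat_div_sqrt_tendsto_fermi[OF c(2)] growth_pos[OF c(1)] by (intro asymp_equiv_if_quotient_tendsto) auto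
  }
qed

end
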